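(* Let $\mathcal{G}\subset\mathbb{R}$ be the set of growth rates of all ideal Coxeter polytopes in hyperbolic $3$-space $\mathbb{H}^3$. Then $\mathcal{G}$ is unbounded above.
   Context: A polytope in hyperbolic $3$-space $\mathbb{H}^3$ is a closed domain $P\subset\mathbb{H}^3$ (with nonempty interior) of finite volume that can be written as the intersection $P=\bigcap H_B$ of finitely many closed half-spaces $H_B$ bounded by hyperplanes $B$ (totally geodesic planes), where for each such $B$ the set $F_B=P\cap B$ is a hyperbolic polygon in $B$. The sets $F_B$ are the facets of $P$. When two facets intersect in a geodesic (segment), this intersection is called an edge of $P$; the dihedral angle at an edge is the angle, measured inside $P$, between the two hyperplanes containing the two facets. A point of the boundary at infinity $\partial\mathbb{H}^3$ at which facets of $P$ meet is an ideal vertex of $P$. The polytope $P$ is ideal if all of its vertices are ideal, i.e. $P$ is the hyperbolic convex hull of finitely many points of $\partial\mathbb{H}^3$. It is a Coxeter polytope if the dihedral angle at each edge is of the form $\pi/k$ with $k\ge 2$ an integer. For a Coxeter polytope $P$, let $S$ be the set of reflections in the hyperplanes supporting its facets (one for each facet) and let $\Gamma$ be the discrete group of isometries of $\mathbb{H}^3$ generated by $S$; $(\Gamma,S)$ is the Coxeter system associated to $P$. The word length $\ell_S(x)$ of $x\in\Gamma$ is the smallest integer $k\ge 0$ such that $x=s_1s_2\cdots s_k$ for some $s_1,\dots,s_k\in S$. Let $a_k$ be the number of $x\in\Gamma$ with $\ell_S(x)=k$. The growth rate of $(\Gamma,S)$, also called the growth rate of $P$, is $\tau=\limsup_{k\to\infty}\sqrt[k]{a_k}$.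 *)

theory Defs
  imports "HOL-Analysis.Analysis" "HOL-Algebra.Bij" "HOL-Algebra.Generated_Groups"
begin

section \<open>Hyperbolic 3-space: the projective (Beltrami--Klein) model\<close>

text \<open>
  A point \<open>x\<close> of the open unit ball stands for the time-like line through \<open>(x, 1)\<close> in
  Minkowski space; the unit sphere is the boundary at infinity. Hyperbolic geodesics, planes
  and convex hulls are the traces on the ball of the Euclidean (affine) ones.
\<close>

definition H3 :: "(real^3) set" where
  "H3 = ball 0 1"

definition ideal_points :: "(real^3) set" where
  "ideal_points = sphere 0 1"

definition lorentz :: "(real^3) \<times> real \<Rightarrow> (real^3) \<times> real \<Rightarrow> real" where
  "lorentz u v = fst u \<bullet> fst v - snd u * snd v"

definition hyp_dist :: "real^3 \<Rightarrow> real^3 \<Rightarrow> real" where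
  "hyp_dist x y =
     arcosh (- lorentz (x, 1) (y, 1) / sqrt (lorentz (x, 1) (x, 1) * lorentz (y, 1) (y, 1)))"

text \<open>The Riemannian volume form of the model in dimension \<open>n\<close> is
  \<open>(1 - |x|\<^sup>2)\<close> to the power \<open>-(n + 1) / 2\<close>.\<close>

definition hyp_volume :: "(real^3) set \<Rightarrow> ennreal" where
  "hyp_volume A = (\<integral>\<^sup>+ x \<in> A. ennreal (1 / (1 - (norm x)\<^sup>2)\<^sup>2) \<partial>lborel)"

text \<open>Hyperplanes are given by space-like normals \<open>u\<close>, i.e. \<open>lorentz u u > 0\<close>; this is
  exactly the condition for the affine plane \<open>{x. fst u \<bullet> x = snd u}\<close> to meet the open ball.
  Positive multiples of \<open>u\<close> give the same half-space, nonzero multiples the same hyperplane.\<close>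

definition spacelike :: "(real^3) \<times> real \<Rightarrow> bool" where
  "spacelike u \<longleftrightarrow> lorentz u u > 0"

definition hyp_plane :: "(real^3) \<times> real \<Rightarrow> (real^3) set" where
  "hyp_plane u = {x \<in> H3. lorentz u (x, 1) = 0}"

definition hyp_halfspace :: "(real^3) \<times> real \<Rightarrow> (real^3) set" where
  "hyp_halfspace u = {x \<in> H3. lorentz u (x, 1) \<le> 0}"

text \<open>The Lorentz reflection \<open>w \<mapsto> w - 2 (\<langle>u,w\<rangle> / \<langle>u,u\<rangle>) u\<close>, read projectively. It depends only on
  the hyperplane of \<open>u\<close>.\<close>

definition hyp_reflection :: "(real^3) \<times> real \<Rightarrow> real^3 \<Rightarrow> real^3" where
  "hyp_reflection u = (\<lambda>x\<in>H3.
     let w = (x, 1) - (2 * lorentz u (x, 1) / lorentz u u) *\<^sub>R u in fst w /\<^sub>R snd w)"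


section \<open>Polytopes\<close>

text \<open>Half-planes of a hyperplane are its intersections with half-spaces.\<close>

definition hyp_polygon :: "(real^3) \<times> real \<Rightarrow> (real^3) set \<Rightarrow> bool" where
  "hyp_polygon u F \<longleftrightarrow>
     (\<exists>N. finite N \<and> (\<forall>v\<in>N. spacelike v) \<and> F = hyp_plane u \<inter> (\<Inter>v\<in>N. hyp_halfspace v)) \<and>
     (top_of_set (hyp_plane u)) interior_of F \<noteq> {}"

text \<open>\<open>u\<close> is an outward normal of a facet \<open>P \<inter> hyp_plane u\<close> of \<open>P\<close>. For a polytope the
  hyperplanes of these \<open>u\<close> are precisely those occurring in any family of half-spaces as in
  \<open>hyp_polytope\<close>.\<close>

definition facet_normal :: "(real^3) set \<Rightarrow> (real^3) \<times> real \<Rightarrow> bool" where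
  "facet_normal P u \<longleftrightarrow>
     spacelike u \<and> P \<subseteq> hyp_halfspace u \<and> hyp_polygon u (P \<inter> hyp_plane u)"

definition hyp_polytope :: "(real^3) set \<Rightarrow> bool" where
  "hyp_polytope P \<longleftrightarrow>
     P \<subseteq> H3 \<and> closedin (top_of_set H3) P \<and> interior P \<noteq> {} \<and> hyp_volume P < \<infinity> \<and>
     (\<exists>N. finite N \<and> (\<forall>u\<in>N. spacelike u) \<and> P = H3 \<inter> (\<Inter>u\<in>N. hyp_halfspace u) \<and>
          (\<forall>u\<in>N. hyp_polygon u (P \<inter> hyp_plane u)))"

definition ideal_polytope :: "(real^3) set \<Rightarrow> bool" where
  "ideal_polytope P \<longleftrightarrow>
     hyp_polytope P \<and> (\<exists>V. finite V \<and> V \<subseteq> ideal_points \<and> P = H3 \<inter> convex hull V)"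

text \<open>The angle of the wedge \<open>hyp_halfspace u \<inter> hyp_halfspace v\<close>, i.e. \<open>\<pi>\<close> minus the angle between
  the outward normals.\<close>

definition dihedral_angle :: "(real^3) \<times> real \<Rightarrow> (real^3) \<times> real \<Rightarrow> real" where
  "dihedral_angle u v = arccos (- lorentz u v / sqrt (lorentz u u * lorentz v v))"

text \<open>Two facets share an edge iff their intersection is one-dimensional; for equal facets the
  dimension is two.\<close>

definition coxeter_polytope :: "(real^3) set \<Rightarrow> bool" where
  "coxeter_polytope P \<longleftrightarrow>
     hyp_polytope P \<and>
     (\<forall>u v. facet_normal P u \<and> facet_normal P v \<and>
            aff_dim ((P \<inter> hyp_plane u) \<inter> (P \<inter> hyp_plane v)) = 1 \<longrightarrow>
            (\<exists>k::nat. k \<ge> 2 \<and> dihedral_angle u v = pi / real k))"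


section \<open>Growth rates\<close>

definition word_length :: "('a, 'b) monoid_scheme \<Rightarrow> 'a set \<Rightarrow> 'a \<Rightarrow> nat" where
  "word_length G S x =
     (LEAST k. \<exists>ws. length ws = k \<and> set ws \<subseteq> S \<and> x = foldr (\<otimes>\<^bsub>G\<^esub>) ws \<one>\<^bsub>G\<^esub>)"

definition sphere_size :: "('a, 'b) monoid_scheme \<Rightarrow> 'a set \<Rightarrow> nat \<Rightarrow> nat" where
  "sphere_size G S k = card {x \<in> generate G S. word_length G S x = k}"

definition growth_rate :: "('a, 'b) monoid_scheme \<Rightarrow> 'a set \<Rightarrow> ereal" where
  "growth_rate G S = limsup (\<lambda>k. ereal (root k (real (sphere_size G S k))))"

definition facet_reflections :: "(real^3) set \<Rightarrow> (real^3 \<Rightarrow> real^3) set" where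
  "facet_reflections P = {hyp_reflection u | u. facet_normal P u}"

definition polytope_growth_rate :: "(real^3) set \<Rightarrow> ereal" where
  "polytope_growth_rate P = growth_rate (BijGroup H3) (facet_reflections P)"

definition ideal_coxeter_growth_rates :: "real set" where
  "ideal_coxeter_growth_rates =
     {\<tau>. \<exists>P. ideal_polytope P \<and> coxeter_polytope P \<and> ereal \<tau> = polytope_growth_rate P}"


section \<open>Consistency of the reflection formula with the metric\<close>

lemma lorentz_reflect:
  assumes "lorentz u u \<noteq> 0"
  shows "lorentz (w - (2 * lorentz u w / lorentz u u) *\<^sub>R u)
                 (w' - (2 * lorentz u w' / lorentz u u) *\<^sub>R u) = lorentz w w'"
proof -
  have ex: "lorentz (w - c *\<^sub>R u) (w' - d *\<^sub>R u)
      = lorentz w w' - d * lorentz u w - c * lorentz u w' + c * d * lorentz u u" for c d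
    by (simp add: lorentz_def algebra_simps inner_commute)
  show ?thesis
    unfolding ex using assms by (simp add: field_simps)
qed

lemma lorentz_self_neg: "x \<in> H3 \<longleftrightarrow> lorentz (x, 1) (x, 1) < 0"
  by (simp add: H3_def lorentz_def norm_lt_square)

lemma reflect_time_pos:
  assumes "spacelike u" "x \<in> H3"
  shows "snd ((x, 1) - (2 * lorentz u (x, 1) / lorentz u u) *\<^sub>R u) > 0"
proof -
  define a b where "a = fst u" and "b = snd u"
  have pos: "a \<bullet> a - b * b > 0"
    using assms(1) by (simp add: spacelike_def lorentz_def a_def b_def)
  have "\<bar>a \<bullet> x\<bar> \<le> norm a * norm x" by (rule Cauchy_Schwarz_ineq2)
  also have "\<dots> \<le> norm a * 1"
    using assms(2) by (intro mult_left_mono) (auto simp: H3_def)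
  finally have ax: "\<bar>a \<bullet> x\<bar> \<le> norm a" by simp
  have "\<bar>b\<bar> * \<bar>a \<bullet> x\<bar> \<le> \<bar>b\<bar> * norm a" using ax by (intro mult_left_mono) auto
  then have "b * (a \<bullet> x) \<le> \<bar>b\<bar> * norm a" by (metis abs_ge_self abs_mult order_trans)
  moreover have "a \<bullet> a = (norm a)\<^sup>2" by (simp add: power2_norm_eq_inner)
  moreover have "norm a \<noteq> \<bar>b\<bar>"
    using pos \<open>a \<bullet> a = (norm a)\<^sup>2\<close> by (metis abs_mult_self_eq less_irrefl power2_eq_square right_minus_eq)
  then have "(norm a - \<bar>b\<bar>)\<^sup>2 > 0" by simp
  then have "(norm a)\<^sup>2 + b * b - 2 * (\<bar>b\<bar> * norm a) > 0"
    by (simp add: power2_diff power2_eq_square algebra_simps)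
  ultimately have num: "a \<bullet> a + b * b - 2 * (b * (a \<bullet> x)) > 0" by linarith
  have "snd ((x, 1) - (2 * lorentz u (x, 1) / lorentz u u) *\<^sub>R u)
      = 1 - 2 * (a \<bullet> x - b) / (a \<bullet> a - b * b) * b"
    by (simp add: lorentz_def a_def b_def)
  also have "\<dots> = (a \<bullet> a + b * b - 2 * (b * (a \<bullet> x))) / (a \<bullet> a - b * b)"
    using pos by (simp add: field_simps)
  also have "\<dots> > 0" using num pos by simp
  finally show ?thesis .
qed

lemma hyp_reflection_lift:
  assumes "spacelike u" "x \<in> H3"
  obtains s where "s > 0"
    "(hyp_reflection u x, 1) = s *\<^sub>R ((x, 1) - (2 * lorentz u (x, 1) / lorentz u u) *\<^sub>R u)"
proof
  define w where "w = (x, 1) - (2 * lorentz u (x, 1) / lorentz u u) *\<^sub>R u"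
  have pos: "snd w > 0" using reflect_time_pos[OF assms] by (simp only: w_def)
  then show "inverse (snd w) > 0" by simp
  have "hyp_reflection u x = fst w /\<^sub>R snd w"
    using assms(2) by (simp only: hyp_reflection_def Let_def w_def restrict_apply if_True)
  then show "(hyp_reflection u x, 1)
      = inverse (snd w) *\<^sub>R ((x, 1) - (2 * lorentz u (x, 1) / lorentz u u) *\<^sub>R u)"
    unfolding w_def[symmetric] using pos by (intro prod_eqI) simp_all
qed

lemma lorentz_scale: "lorentz (s *\<^sub>R v) (t *\<^sub>R w) = s * t * lorentz v w"
  by (simp add: lorentz_def algebra_simps)

lemma lorentz_diff_scale: "lorentz u (w - c *\<^sub>R v) = lorentz u w - c * lorentz u v"
  by (simp add: lorentz_def algebra_simps)

lemma hyp_reflection_in_H3: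
  assumes "spacelike u" "x \<in> H3"
  shows "hyp_reflection u x \<in> H3"
proof -
  obtain s where "s > 0"
    "(hyp_reflection u x, 1) = s *\<^sub>R ((x, 1) - (2 * lorentz u (x, 1) / lorentz u u) *\<^sub>R u)"
    using hyp_reflection_lift[OF assms] .
  moreover have nz: "lorentz u u \<noteq> 0" using assms(1) by (simp add: spacelike_def)
  ultimately have "lorentz (hyp_reflection u x, 1) (hyp_reflection u x, 1)
      = s * s * lorentz (x, 1) (x, 1)"
    by (simp only: lorentz_scale lorentz_reflect[OF nz])
  then show ?thesis
    using \<open>s > 0\<close> assms(2) by (simp add: lorentz_self_neg mult_pos_neg)
qed

lemma hyp_reflection_isometry:
  assumes "spacelike u" "x \<in> H3" "y \<in> H3"
  shows "hyp_dist (hyp_reflection u x) (hyp_reflection u y) = hyp_dist x y"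
proof -
  obtain s where s: "s > 0"
    "(hyp_reflection u x, 1) = s *\<^sub>R ((x, 1) - (2 * lorentz u (x, 1) / lorentz u u) *\<^sub>R u)"
    using hyp_reflection_lift[OF assms(1,2)] .
  obtain t where t: "t > 0"
    "(hyp_reflection u y, 1) = t *\<^sub>R ((y, 1) - (2 * lorentz u (y, 1) / lorentz u u) *\<^sub>R u)"
    using hyp_reflection_lift[OF assms(1,3)] .
  have nz: "lorentz u u \<noteq> 0" using assms(1) by (simp add: spacelike_def)
  have eq: "sqrt ((s * s * p) * (t * t * q)) = s * t * sqrt (p * q)" for p q
  proof -
    have "(s * s * p) * (t * t * q) = (s * t)\<^sup>2 * (p * q)" by (simp add: power2_eq_square)
    then show ?thesis using s(1) t(1) by (simp add: real_sqrt_mult)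
  qed
  show ?thesis
    unfolding hyp_dist_def s(2) t(2) lorentz_scale lorentz_reflect[OF nz] eq
    using s(1) t(1) by simp
qed

lemma hyp_reflection_fixes_iff:
  assumes "spacelike u" "x \<in> H3"
  shows "hyp_reflection u x = x \<longleftrightarrow> x \<in> hyp_plane u"
proof
  assume "x \<in> hyp_plane u"
  then show "hyp_reflection u x = x"
    by (simp add: hyp_plane_def hyp_reflection_def Let_def)
next
  assume fx: "hyp_reflection u x = x"
  obtain s where s: "s > 0"
    "(hyp_reflection u x, 1) = s *\<^sub>R ((x, 1) - (2 * lorentz u (x, 1) / lorentz u u) *\<^sub>R u)"
    using hyp_reflection_lift[OF assms] .
  have nz: "lorentz u u \<noteq> 0" using assms(1) by (simp add: spacelike_def)
  have "lorentz (1 *\<^sub>R u) (x, 1) = lorentz (1 *\<^sub>R u) (s *\<^sub>R ((x, 1) - (2 * lorentz u (x, 1) / lorentz u u) *\<^sub>R u))"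
    using s(2) fx by simp
  also have "\<dots> = s * (lorentz u (x, 1) - 2 * lorentz u (x, 1) / lorentz u u * lorentz u u)"
    unfolding lorentz_scale lorentz_diff_scale by simp
  also have "\<dots> = - s * lorentz u (x, 1)" using nz by simp
  finally have "(1 + s) * lorentz u (x, 1) = 0" by (simp add: algebra_simps)
  then show "x \<in> hyp_plane u" using s(1) assms(2) by (simp add: hyp_plane_def)
qed

lemma hyp_reflection_involution:
  assumes "spacelike u" "x \<in> H3"
  shows "hyp_reflection u (hyp_reflection u x) = x"
proof -
  have nz: "lorentz u u \<noteq> 0" using assms(1) by (simp add: spacelike_def)
  define y c where "y = hyp_reflection u x" and "c = 2 * lorentz u (x, 1) / lorentz u u"
  obtain s where s: "s > 0" "(y, 1) = s *\<^sub>R ((x, 1) - c *\<^sub>R u)"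
    using hyp_reflection_lift[OF assms] unfolding y_def c_def .
  have "y \<in> H3" unfolding y_def by (rule hyp_reflection_in_H3[OF assms])
  then obtain t where t: "t > 0"
    "(hyp_reflection u y, 1) = t *\<^sub>R ((y, 1) - (2 * lorentz u (y, 1) / lorentz u u) *\<^sub>R u)"
    using hyp_reflection_lift[OF assms(1)] by blast
  have "lorentz u (y, 1) = s * (lorentz u (x, 1) - c * lorentz u u)"
    using lorentz_scale[of 1 u s "(x, 1) - c *\<^sub>R u"] s(2) by (simp add: lorentz_diff_scale)
  also have "\<dots> = - s * lorentz u (x, 1)" using nz by (simp add: c_def)
  finally have "2 * lorentz u (y, 1) / lorentz u u = - s * c" by (simp add: c_def)
  then have "(hyp_reflection u y, 1) = t *\<^sub>R (s *\<^sub>R ((x, 1) - c *\<^sub>R u) - (- s * c) *\<^sub>R u)"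
    using t(2) s(2) by simp
  also have "\<dots> = (t * s) *\<^sub>R (x, 1)"
    by (simp add: prod_eq_iff algebra_simps)
  finally have "hyp_reflection u y = (t * s) *\<^sub>R x" "t * s = 1" by simp_all
  then show ?thesis by (simp add: y_def)
qed

lemma facet_reflections_subset: "facet_reflections P \<subseteq> carrier (BijGroup H3)"
proof -
  have "hyp_reflection u \<in> Bij H3" if "spacelike u" for u
    unfolding Bij_def
    by (intro IntI CollectI bij_betw_byWitness[where f' = "hyp_reflection u"])
       (auto simp: hyp_reflection_involution hyp_reflection_in_H3 that,
        simp add: hyp_reflection_def extensional_def)
  then show ?thesis
    by (auto simp: facet_reflections_def facet_normal_def BijGroup_def)
qed

end

theory Submission imports Defs begin

text \<open>In the upper half-space, take the region above \<open>n\<close> hemispheres of radius \<open>1 / sqrt 2\<close> centred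
  at the midpoints of the unit squares of \<open>[0, n] \<times> [0, 1]\<close> and inside the four vertical walls over
  the sides of this rectangle: a row of \<open>n\<close> ideal square pyramids with common apex at infinity.
  Hemispheres meet the walls at \<open>\<pi> / 4\<close> and their neighbours at \<open>\<pi> / 2\<close>, so this is an ideal Coxeter
  polytope. Every second hemisphere bounds disjoint half-spaces, so by ping-pong the products of the
  reflections in these hemispheres with a fixed one of them generate a free monoid, whose rank tends
  to infinity with \<open>n\<close>.

  The volume is finite since \<open>1 - |x|\<^sup>2\<close> is bounded below on the hull of finitely many points of the
  sphere by a multiple of the distance from \<open>x\<close> to the nearest of them, and \<open>1 / |x|\<^sup>2\<close> is integrable
  near the origin of three-space.\<close>

section \<open>Facets of intersections of half-spaces\<close>

lemma lorentz_point: "lorentz u (x, 1) = fst u \<bullet> x - snd u"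
  by (simp add: lorentz_def)

lemma spacelike_fst_nonzero: "spacelike u \<Longrightarrow> fst u \<noteq> 0"
  by (auto simp: spacelike_def lorentz_def not_less)

lemma strict_halfspaces_contain_ball:
  assumes "finite N" "x \<in> H3" "\<And>v. v \<in> N \<Longrightarrow> lorentz v (x, 1) < 0"
  obtains e where "e > 0" "ball x e \<subseteq> H3 \<inter> (\<Inter>v\<in>N. hyp_halfspace v)"
proof -
  define U where "U = H3 \<inter> (\<Inter>v\<in>N. {y. fst v \<bullet> y < snd v})"
  have "open U"
    unfolding U_def H3_def using assms(1) by (intro open_Int open_INT) (auto simp: open_halfspace_lt)
  moreover have "x \<in> U" using assms(2,3) by (auto simp: U_def lorentz_point)
  ultimately obtain e where "e > 0" "ball x e \<subseteq> U" by (meson open_contains_ball)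
  moreover have "U \<subseteq> H3 \<inter> (\<Inter>v\<in>N. hyp_halfspace v)"
    by (auto simp: U_def hyp_halfspace_def lorentz_point intro: less_imp_le)
  ultimately show ?thesis using that by blast
qed

text \<open>A small ball around \<open>x\<close> satisfies all constraints other than that of
  \<open>u\<close>, and the plane of \<open>u\<close> lies in its own half-space. So the ball meets
  the plane in a relatively open piece of the facet.\<close>

lemma hyp_polygon_of_point:
  assumes "finite N" "\<And>v. v \<in> N \<Longrightarrow> spacelike v"
    and "x \<in> hyp_plane u" "\<And>v. v \<in> N - {u} \<Longrightarrow> lorentz v (x, 1) < 0"
  shows "hyp_polygon u ((H3 \<inter> (\<Inter>v\<in>N. hyp_halfspace v)) \<inter> hyp_plane u)"
proof -
  define F where "F = (H3 \<inter> (\<Inter>v\<in>N. hyp_halfspace v)) \<inter> hyp_plane u"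
  have "x \<in> H3" using assms(3) by (simp add: hyp_plane_def)
  then obtain e where e: "e > 0" "ball x e \<subseteq> H3 \<inter> (\<Inter>v\<in>N - {u}. hyp_halfspace v)"
    using strict_halfspaces_contain_ball[of "N - {u}" x] assms by blast
  have sub: "hyp_plane u \<subseteq> hyp_halfspace u"
    by (auto simp: hyp_plane_def hyp_halfspace_def)
  have "hyp_plane u \<inter> ball x e \<subseteq> F"
  proof
    fix y assume y: "y \<in> hyp_plane u \<inter> ball x e"
    then have "y \<in> hyp_halfspace v" if "v \<in> N" for v
      using e(2) sub that by (cases "v = u") blast+
    then show "y \<in> F" using y e(2) by (auto simp: F_def)
  qed
  moreover have "openin (top_of_set (hyp_plane u)) (hyp_plane u \<inter> ball x e)"
    by (simp add: openin_open_Int)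
  ultimately have "hyp_plane u \<inter> ball x e \<subseteq> (top_of_set (hyp_plane u)) interior_of F"
    by (rule interior_of_maximal)
  then have "(top_of_set (hyp_plane u)) interior_of F \<noteq> {}"
    using assms(3) e(1) by force
  moreover have "F = hyp_plane u \<inter> (\<Inter>v\<in>N. hyp_halfspace v)"
    by (auto simp: F_def hyp_plane_def)
  ultimately show ?thesis
    unfolding hyp_polygon_def F_def[symmetric] using assms(1,2) by blast
qed

text \<open>The ball is chosen inside \<open>H3\<close>, so the disc can be cut out by the affine
  plane alone.\<close>

lemma hyp_polygon_contains_disc:
  assumes "hyp_polygon u F"
  obtains x e where "x \<in> H3" "fst u \<bullet> x = snd u" "e > 0"
    "{y. fst u \<bullet> y = snd u} \<inter> ball x e \<subseteq> F"
proof -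
  obtain x where "x \<in> (top_of_set (hyp_plane u)) interior_of F"
    using assms by (auto simp: hyp_polygon_def)
  then obtain T where T: "openin (top_of_set (hyp_plane u)) T" "x \<in> T" "T \<subseteq> F"
    by (auto simp: interior_of_def)
  then obtain W where W: "open W" "T = hyp_plane u \<inter> W" by (auto simp: openin_open)
  have "open (H3 \<inter> W)" using W(1) by (auto simp: H3_def)
  moreover have x: "x \<in> H3 \<inter> W" using T(2) W(2) by (auto simp: hyp_plane_def)
  ultimately obtain e where e: "e > 0" "ball x e \<subseteq> H3 \<inter> W" by (meson open_contains_ball)
  show ?thesis
  proof (rule that[of x e])
    show "fst u \<bullet> x = snd u" using T(2) W(2) by (auto simp: hyp_plane_def lorentz_point)
    show "{y. fst u \<bullet> y = snd u} \<inter> ball x e \<subseteq> F"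
      using e(2) T(3) W(2) by (auto simp: hyp_plane_def lorentz_point)
  qed (use x e(1) in auto)
qed

text \<open>This tells a facet from an edge: dimension 1 in the Coxeter condition excludes two
  normals of the same facet.\<close>

lemma aff_dim_hyp_polygon:
  assumes "spacelike u" "hyp_polygon u F"
  shows "aff_dim F \<ge> 2"
proof -
  obtain x e where "x \<in> H3" "fst u \<bullet> x = snd u" "e > 0"
    and sub: "{y. fst u \<bullet> y = snd u} \<inter> ball x e \<subseteq> F"
    using hyp_polygon_contains_disc[OF assms(2)] .
  then have "x \<in> {y. fst u \<bullet> y = snd u} \<inter> ball x e" by simp
  then have "aff_dim ({y. fst u \<bullet> y = snd u} \<inter> ball x e) = aff_dim {y. fst u \<bullet> y = snd u}"
    by (intro aff_dim_convex_Int_open) (auto simp: convex_hyperplane)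
  also have "\<dots> = 2"
    using spacelike_fst_nonzero[OF assms(1)] by (simp add: aff_dim_hyperplane)
  finally show ?thesis using aff_dim_subset[OF sub] by simp
qed

text \<open>\<open>facet_normal\<close> ranges over all space-like vectors; this brings it back to
  the given family. A relative interior point of the facet of \<open>u\<close> lies on the boundary
  of \<open>P\<close>, so some \<open>v\<close> in \<open>N\<close> is tight there. On a disc in the
  plane of \<open>u\<close> the functional of \<open>v\<close> is maximal at the centre, hence
  constant, so the two planes agree. An interior point of \<open>P\<close> fixes the sign.\<close>

lemma facet_normal_multiple:
  assumes N: "finite N" "\<And>v. v \<in> N \<Longrightarrow> spacelike v"
      "P = H3 \<inter> (\<Inter>v\<in>N. hyp_halfspace v)"
    and int: "interior P \<noteq> {}" and u: "facet_normal P u"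
  obtains v c where "v \<in> N" "c > 0" "u = c *\<^sub>R v"
proof -
  have su: "spacelike u" and Pu: "P \<subseteq> hyp_halfspace u" and pu: "hyp_polygon u (P \<inter> hyp_plane u)"
    using u by (auto simp: facet_normal_def)
  obtain x e where x: "x \<in> H3" "fst u \<bullet> x = snd u" "e > 0"
    and sub: "{y. fst u \<bullet> y = snd u} \<inter> ball x e \<subseteq> P \<inter> hyp_plane u"
    using hyp_polygon_contains_disc[OF pu] .
  have u0: "fst u \<noteq> 0" using su by (rule spacelike_fst_nonzero)
  \<comment> \<open>If all constraints were strict at \<open>x\<close>, a small move along the
    outward direction \<open>fst u\<close> would stay in \<open>P\<close> but leave the half-space
    of \<open>u\<close>.\<close>
  have "\<exists>v\<in>N. lorentz v (x, 1) \<ge> 0"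
  proof (rule ccontr)
    assume "\<not> ?thesis"
    then obtain d where d: "d > 0" "ball x d \<subseteq> P"
      using strict_halfspaces_contain_ball[OF N(1) x(1)] unfolding N(3) by (metis not_le)
    define y where "y = x + (d / (2 * norm (fst u))) *\<^sub>R fst u"
    have "y \<in> ball x d" using d(1) u0 by (simp add: y_def dist_norm)
    then have "lorentz u (y, 1) \<le> 0" using d(2) Pu by (auto simp: hyp_halfspace_def)
    moreover have "lorentz u (y, 1) = d / (2 * norm (fst u)) * (fst u \<bullet> fst u)"
      using x(2) by (simp add: y_def lorentz_point inner_add_right)
    moreover have "\<dots> > 0" using d(1) u0 by simp
    ultimately show False by linarith
  qed
  then obtain v where v: "v \<in> N" "lorentz v (x, 1) \<ge> 0" by blast
  have le: "fst v \<bullet> y \<le> snd v" if "y \<in> P" for y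
    using that v(1) by (auto simp: N(3) hyp_halfspace_def lorentz_point)
  have ule: "fst u \<bullet> y \<le> snd u" if "y \<in> P" for y
    using that Pu by (auto simp: hyp_halfspace_def lorentz_point)
  have "x \<in> P" using sub x by auto
  then have vx: "fst v \<bullet> x = snd v" using le[of x] v(2) by (simp add: lorentz_point)
  have orth: "fst v \<bullet> d = 0" if d: "fst u \<bullet> d = 0" for d
  proof (cases "d = 0")
    case False
    define k where "k = e / (2 * norm d)"
    have k: "k > 0" using x(3) False by (simp add: k_def)
    have "k * norm d < e" using x(3) False by (simp add: k_def)
    then have "x + k *\<^sub>R d \<in> P" "x - k *\<^sub>R d \<in> P"
      using sub k x(2) d by (auto simp: dist_norm inner_add_right inner_diff_right)
    from le[OF this(1)] le[OF this(2)] have "k * (fst v \<bullet> d) = 0"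
      using vx by (simp add: inner_add_right inner_diff_right)
    then show ?thesis using k by simp
  qed simp
  define c where "c = (fst v \<bullet> fst u) / (fst u \<bullet> fst u)"
  have uu: "fst u \<bullet> fst u > 0" using u0 by simp
  define d where "d = fst v - c *\<^sub>R fst u"
  have ud: "fst u \<bullet> d = 0"
    using uu by (simp add: d_def c_def inner_diff_right inner_commute)
  have "d \<bullet> d = fst v \<bullet> d - c * (fst u \<bullet> d)"
    by (simp add: d_def inner_diff_left)
  also have "\<dots> = 0" using orth[OF ud] ud by simp
  finally have fv: "fst v = c *\<^sub>R fst u" by (simp add: d_def)
  then have vcu: "v = c *\<^sub>R u" using vx x(2) by (simp add: prod_eq_iff)
  obtain p r where p: "r > 0" "ball p r \<subseteq> P"
    using int by (meson ex_in_conv mem_interior)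
  \<comment> \<open>Pushing an interior point inwards makes the constraint of \<open>u\<close>
    strict, which rules out a negative \<open>c\<close>.\<close>
  define y where "y = p - (r / (2 * norm (fst u))) *\<^sub>R fst u"
  have "y \<in> P" using p u0 by (auto simp: y_def dist_norm subset_iff)
  have "p \<in> P" using p by auto
  have "fst u \<bullet> y = fst u \<bullet> p - r / (2 * norm (fst u)) * (fst u \<bullet> fst u)"
    by (simp add: y_def inner_diff_right)
  moreover have "r / (2 * norm (fst u)) * (fst u \<bullet> fst u) > 0" using p(1) u0 by simp
  ultimately have yneg: "fst u \<bullet> y < snd u" using ule[OF \<open>p \<in> P\<close>] by linarith
  have "c \<noteq> 0" using spacelike_fst_nonzero[OF N(2)[OF v(1)]] fv by auto
  moreover have "c \<ge> 0"
  proof (rule ccontr)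
    assume "\<not> c \<ge> 0"
    then have "c * (fst u \<bullet> y) > c * snd u" using yneg by simp
    then show False using le[OF \<open>y \<in> P\<close>] vcu by simp
  qed
  ultimately show ?thesis using that[OF v(1), of "1 / c"] vcu by simp
qed

section \<open>Finite volume of ideal polytopes\<close>

text \<open>Dyadic domination: where \<open>1 / 2 ^ k < dist x v\<close> the integrand is at most
  \<open>4 ^ k\<close>, and the ball of radius \<open>2 / 2 ^ k\<close> has volume proportional to
  \<open>1 / 8 ^ k\<close>. This leaves a geometric series of ratio 1/2.\<close>

lemma nn_integral_inverse_square_finite:
  fixes v :: "real^3"
  shows "(\<integral>\<^sup>+x\<in>cball v 2. ennreal (1 / (dist x v)\<^sup>2) \<partial>lborel) < \<infinity>"
proof -
  define c where "c = unit_ball_vol 3"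
  have c: "c \<ge> 0" by (simp add: c_def)
  define f where "f k x = ennreal (4 ^ k) * indicator (cball v (2 / 2 ^ k)) x" for k :: nat and x :: "real^3"
  have ptw: "ennreal (1 / (dist x v)\<^sup>2) * indicator (cball v 2) x \<le> (\<Sum>k. f k x)" for x
  \<comment> \<open>At \<open>x = v\<close> the integrand is \<open>1 / 0 = 0\<close>, so the centre
    falls into the trivial case.\<close>
  proof (cases "x \<in> cball v 2 \<and> x \<noteq> v")
    case True
    define d where "d = dist x v"
    have d: "0 < d" "d \<le> 2" using True by (auto simp: d_def dist_commute)
    define k where "k = (LEAST k. 1 / 2 ^ k < d)"
    have "\<exists>k. 1 / 2 ^ k < d"
      using real_arch_pow_inv[OF d(1), of "1/2"] by (auto simp: power_one_over)
    then have k: "1 / 2 ^ k < d" unfolding k_def by (rule LeastI_ex)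
    \<comment> \<open>Minimality of \<open>k\<close> bounds \<open>d\<close> from above, except for
      \<open>k = 0\<close>, where the radius 2 of the domain does.\<close>
    have "d \<le> 2 / 2 ^ k"
    proof (cases k)
      case (Suc l)
      then have "\<not> 1 / 2 ^ l < d" using not_less_Least[of l "\<lambda>k. 1 / 2 ^ k < d"] by (simp add: k_def)
      then show ?thesis using Suc by simp
    qed (use d in simp)
    then have "x \<in> cball v (2 / 2 ^ k)" by (simp add: d_def dist_commute)
    moreover have "(1 / 2 ^ k)\<^sup>2 \<le> d\<^sup>2" using k by (intro power_mono) auto
    then have "1 / 4 ^ k \<le> d\<^sup>2"
      by (simp add: power_divide power2_eq_square flip: power_mult_distrib)
    then have "1 / d\<^sup>2 \<le> 4 ^ k"
      using d(1) by (simp add: divide_simps mult.commute)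
    ultimately have "ennreal (1 / (dist x v)\<^sup>2) * indicator (cball v 2) x \<le> f k x"
      using True by (simp add: f_def d_def[symmetric] ennreal_leI)
    also have "\<dots> \<le> (\<Sum>k. f k x)" using sum_le_suminf[of "\<lambda>k. f k x" "{k}"] by simp
    finally show ?thesis .
  qed auto
  have "(\<integral>\<^sup>+x\<in>cball v 2. ennreal (1 / (dist x v)\<^sup>2) \<partial>lborel) \<le> (\<integral>\<^sup>+x. (\<Sum>k. f k x) \<partial>lborel)"
    by (intro nn_integral_mono ptw)
  also have "\<dots> = (\<Sum>k. \<integral>\<^sup>+x. f k x \<partial>lborel)"
    unfolding f_def by (intro nn_integral_suminf borel_measurable_times_ennreal borel_measurable_indicator) auto
  also have "(\<lambda>k. \<integral>\<^sup>+x. f k x \<partial>lborel) = (\<lambda>k. ennreal (8 * c * (1 / 2) ^ k))"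
  proof
    fix k
    have "(2 ^ k) ^ 3 = 2 ^ k * (4 ^ k :: real)"
      by (simp add: power3_eq_cube flip: power_mult_distrib)
    then have pow: "4 ^ k * (c * (2 / 2 ^ k) ^ 3) = 8 * c * (1 / 2) ^ k"
      by (simp add: power_divide)
    have "(\<integral>\<^sup>+x. f k x \<partial>lborel) = ennreal (4 ^ k) * ennreal (c * (2 / 2 ^ k) ^ 3)"
      by (simp add: f_def nn_integral_cmult_indicator emeasure_cball c_def)
    also have "\<dots> = ennreal (4 ^ k * (c * (2 / 2 ^ k) ^ 3))"
      using c by (simp add: ennreal_mult')
    finally show "(\<integral>\<^sup>+x. f k x \<partial>lborel) = ennreal (8 * c * (1 / 2) ^ k)"
      by (simp only: pow)
  qed
  also have "(\<Sum>k. ennreal (8 * c * (1 / 2) ^ k)) = ennreal (\<Sum>k. 8 * c * (1 / 2) ^ k)"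
    using c by (intro suminf_ennreal2 summable_mult summable_geometric) auto
  also have "\<dots> < \<infinity>" by simp
  finally show ?thesis .
qed

lemma finite_set_separated:
  fixes V :: "'a::metric_space set"
  assumes "finite V"
  obtains d where "d > 0" "\<And>v w. v \<in> V \<Longrightarrow> w \<in> V \<Longrightarrow> v \<noteq> w \<Longrightarrow> d \<le> dist v w"
proof -
  \<comment> \<open>The element 1 keeps \<open>D\<close> nonempty when \<open>V\<close> has at most
    one point.\<close>
  define D where "D = insert 1 ((\<lambda>(v, w). dist v w) ` {(v, w) \<in> V \<times> V. v \<noteq> w})"
  have "finite {(v, w) \<in> V \<times> V. v \<noteq> w}"
    by (rule finite_subset[of _ "V \<times> V"]) (use assms in auto)
  then have D: "finite D" "D \<noteq> {}" by (auto simp: D_def)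
  show ?thesis
  proof (rule that[of "Min D"])
    show "Min D > 0" using D by (auto simp: D_def)
    show "Min D \<le> dist v w" if "v \<in> V" "w \<in> V" "v \<noteq> w" for v w
      using D that by (intro Min_le) (auto simp: D_def)
  qed
qed

text \<open>For \<open>x = \<Sum> l v *\<^sub>R v\<close> one has \<open>1 - |x|\<^sup>2 = \<Sum> l m * (1 - x \<bullet> m)\<close> with nonnegative terms,
  and \<open>1 - x \<bullet> m = \<Sum> l v * |v - m|\<^sup>2 / 2\<close>. The term of largest weight suffices.\<close>

lemma convex_hull_sphere_conical_bound:
  fixes V :: "'a::euclidean_space set"
  assumes V: "finite V" "V \<subseteq> sphere 0 1"
  obtains c where "c > 0"
    "\<And>x. x \<in> convex hull V \<Longrightarrow> \<exists>m\<in>V. c * dist x m \<le> 1 - (norm x)\<^sup>2"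
proof -
  obtain d where d: "d > 0" "\<And>v w. v \<in> V \<Longrightarrow> w \<in> V \<Longrightarrow> v \<noteq> w \<Longrightarrow> d \<le> dist v w"
    using finite_set_separated[OF V(1)] by blast
  have unit: "v \<bullet> v = 1" if "v \<in> V" for v
    using that V(2) by (auto simp: dot_square_norm)
  \<comment> \<open>The factor \<open>d / 2\<close> comes from
    \<open>(dist v m)\<^sup>2 \<ge> d * dist v m\<close>; the other factor bounds the largest weight
    from below. Adding 1 keeps \<open>c\<close> positive when \<open>V\<close> is empty.\<close>
  define c where "c = d / (2 * (real (card V) + 1))"
  have "c > 0" using d(1) by (simp add: c_def)
  moreover have "\<exists>m\<in>V. c * dist x m \<le> 1 - (norm x)\<^sup>2" if "x \<in> convex hull V" for x
  proof -
    from that obtain l where l: "\<And>v. v \<in> V \<Longrightarrow> 0 \<le> l v" "sum l V = 1" "(\<Sum>v\<in>V. l v *\<^sub>R v) = x"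
      using V(1) by (auto simp: convex_hull_finite)
    have "V \<noteq> {}" using l(2) by auto
    then have "Max (l ` V) \<in> l ` V" using V(1) by (intro Max_in) auto
    then obtain m where "m \<in> V" "Max (l ` V) = l m" by blast
    then have m: "m \<in> V" "\<And>v. v \<in> V \<Longrightarrow> l v \<le> l m"
      using V(1) by (auto simp flip: \<open>Max (l ` V) = l m\<close>)
    have "1 \<le> real (card V) * l m"
      using sum_bounded_above[of V l "l m"] m(2) l(2) by simp
    then have lm: "1 / (real (card V) + 1) \<le> l m"
      using l(1)[OF m(1)] by (simp add: field_simps)
    have xm: "1 - x \<bullet> w = (\<Sum>v\<in>V. l v * ((dist v w)\<^sup>2 / 2))" if w: "w \<in> V" for w
    proof -
      have "x \<bullet> w = (\<Sum>v\<in>V. l v * (v \<bullet> w))"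
        by (simp add: l(3)[symmetric] inner_sum_left)
      then have "1 - x \<bullet> w = (\<Sum>v\<in>V. l v * (1 - v \<bullet> w))"
        using l(2) by (simp add: algebra_simps sum_subtractf)
      also have "\<dots> = (\<Sum>v\<in>V. l v * ((dist v w)\<^sup>2 / 2))"
      proof (rule sum.cong)
        fix v assume "v \<in> V"
        then show "l v * (1 - v \<bullet> w) = l v * ((dist v w)\<^sup>2 / 2)"
          using unit[of v] unit[OF w]
          by (simp add: dist_norm power2_norm_eq_inner inner_diff_left inner_diff_right inner_commute)
      qed simp
      finally show ?thesis .
    qed
    have nonneg: "0 \<le> 1 - x \<bullet> w" if "w \<in> V" for w
      unfolding xm[OF that] using l(1) by (intro sum_nonneg) auto
    have "x - m = (\<Sum>v\<in>V. l v *\<^sub>R (v - m))"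
      using l(2,3) by (simp add: algebra_simps sum_subtractf flip: scaleR_sum_left)
    then have "dist x m \<le> (\<Sum>v\<in>V. norm (l v *\<^sub>R (v - m)))"
      by (metis dist_norm norm_sum)
    also have "\<dots> = (\<Sum>v\<in>V. l v * dist v m)"
      using l(1) by (intro sum.cong) (auto simp: dist_norm)
    finally have "d / 2 * dist x m \<le> d / 2 * (\<Sum>v\<in>V. l v * dist v m)"
      using d(1) by (intro mult_left_mono) auto
    also have "\<dots> = (\<Sum>v\<in>V. l v * (d * dist v m / 2))"
      by (simp add: sum_distrib_left algebra_simps)
    also have "\<dots> \<le> (\<Sum>v\<in>V. l v * ((dist v m)\<^sup>2 / 2))"
    proof (intro sum_mono mult_left_mono)
      fix v assume "v \<in> V"
      then show "d * dist v m / 2 \<le> (dist v m)\<^sup>2 / 2"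
        using d(2)[of v m] m(1) by (cases "v = m") (auto simp: power2_eq_square)
    qed (use l(1) in auto)
    also have "\<dots> = 1 - x \<bullet> m" using xm[OF m(1)] by simp
    finally have B: "d / 2 * dist x m \<le> 1 - x \<bullet> m" .
    have "c * dist x m = 1 / (real (card V) + 1) * (d / 2 * dist x m)"
      by (simp add: c_def field_simps)
    also have "\<dots> \<le> l m * (1 - x \<bullet> m)"
      using lm B d(1) l(1)[OF m(1)] by (intro mult_mono) auto
    also have "\<dots> \<le> (\<Sum>w\<in>V. l w * (1 - x \<bullet> w))"
      using V(1) m(1) l(1) nonneg by (intro member_le_sum) auto
    also have "\<dots> = 1 - x \<bullet> x"
    proof -
      have "x \<bullet> x = (\<Sum>w\<in>V. l w * (x \<bullet> w))"
        by (subst (2) l(3)[symmetric]) (simp add: inner_sum_right)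
      then show ?thesis using l(2) by (simp add: algebra_simps sum_subtractf)
    qed
    finally show ?thesis using m(1) by (auto simp: power2_norm_eq_inner)
  qed
  ultimately show ?thesis using that by blast
qed

text \<open>The density is at most \<open>1 / (c * dist x m)\<^sup>2\<close> for a vertex
  \<open>m\<close> depending on \<open>x\<close>; summing over all vertices removes this dependence.
  A ball of radius 2 about any vertex covers the unit ball.\<close>

lemma hyp_volume_ideal_hull_finite:
  assumes V: "finite V" "V \<subseteq> ideal_points"
  shows "hyp_volume (H3 \<inter> convex hull V) < \<infinity>"
proof -
  have V1: "V \<subseteq> sphere 0 1" using V(2) by (simp add: ideal_points_def)
  obtain c where c: "c > 0"
    "\<And>x. x \<in> convex hull V \<Longrightarrow> \<exists>m\<in>V. c * dist x m \<le> 1 - (norm x)\<^sup>2"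
    using convex_hull_sphere_conical_bound[OF V(1) V1] by blast
  define g where "g m x = ennreal (1 / (dist x m)\<^sup>2) * indicator (cball m 2) x" for m x :: "real^3"
  have meas: "g m \<in> borel_measurable lborel" for m
    unfolding g_def by (intro borel_measurable_times_ennreal borel_measurable_indicator) auto
  have "ennreal (1 / (1 - (norm x)\<^sup>2)\<^sup>2) * indicator (H3 \<inter> convex hull V) x
      \<le> (\<Sum>m\<in>V. ennreal (1 / c\<^sup>2) * g m x)" for x
  proof (cases "x \<in> H3 \<inter> convex hull V")
    case True
    then obtain m where m: "m \<in> V" "c * dist x m \<le> 1 - (norm x)\<^sup>2" using c(2) by blast
    have nx: "norm x < 1" using True by (simp add: H3_def)
    have nm: "norm m = 1" using m(1) V1 by auto
    have "dist m x \<le> 2" using norm_triangle_ineq4[of m x] nx nm by (simp add: dist_norm)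
    moreover have "dist x m > 0" using nx nm by auto
    then have "0 < c * dist x m" using c(1) by simp
    then have "1 / (1 - (norm x)\<^sup>2)\<^sup>2 \<le> 1 / (c * dist x m)\<^sup>2"
      using m(2) c(1) by (intro divide_left_mono power_mono mult_pos_pos zero_less_power) auto
    then have "ennreal (1 / (1 - (norm x)\<^sup>2)\<^sup>2) \<le> ennreal (1 / c\<^sup>2) * ennreal (1 / (dist x m)\<^sup>2)"
      by (subst ennreal_mult[symmetric]) (auto simp: power_mult_distrib intro!: ennreal_leI)
    ultimately have "ennreal (1 / (1 - (norm x)\<^sup>2)\<^sup>2) * indicator (H3 \<inter> convex hull V) x
        \<le> ennreal (1 / c\<^sup>2) * g m x"
      using True by (simp add: g_def)
    also have "\<dots> \<le> (\<Sum>m\<in>V. ennreal (1 / c\<^sup>2) * g m x)"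
      using V(1) m(1) by (intro member_le_sum) auto
    finally show ?thesis .
  qed simp
  then have "hyp_volume (H3 \<inter> convex hull V)
      \<le> (\<integral>\<^sup>+x. (\<Sum>m\<in>V. ennreal (1 / c\<^sup>2) * g m x) \<partial>lborel)"
    unfolding hyp_volume_def by (intro nn_integral_mono)
  also have "\<dots> = (\<Sum>m\<in>V. ennreal (1 / c\<^sup>2) * (\<integral>\<^sup>+x. g m x \<partial>lborel))"
    using meas by (simp add: nn_integral_sum nn_integral_cmult)
  also have "\<dots> < \<infinity>"
    unfolding infinity_ennreal_def ennreal_sum_less_top[OF V(1)] g_def
    using nn_integral_inverse_square_finite by (simp add: ennreal_mult_less_top)
  finally show ?thesis .
qed

section \<open>Growth of groups generated by reflections\<close>

context group
begin

abbreviation word_prod :: "'a list \<Rightarrow> 'a" where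
  "word_prod ws \<equiv> foldr (\<otimes>) ws \<one>"

lemma word_prod_closed: "set ws \<subseteq> carrier G \<Longrightarrow> word_prod ws \<in> carrier G"
  by (induction ws) auto

lemma word_prod_append:
  "set xs \<subseteq> carrier G \<Longrightarrow> set ys \<subseteq> carrier G \<Longrightarrow> word_prod (xs @ ys) = word_prod xs \<otimes> word_prod ys"
  by (induction xs) (auto simp: m_assoc word_prod_closed)

lemma word_prod_in_generate: "set ws \<subseteq> S \<Longrightarrow> word_prod ws \<in> generate G S"
  by (induction ws) (auto intro: generate.intros)

text \<open>Involutions are their own inverses, so every element has an inverse-free spelling in
  \<open>S\<close>. Hence the \<open>LEAST\<close> in \<open>word_length\<close> is
  attained.\<close>

lemma generate_involutions_word:
  assumes "S \<subseteq> carrier G" "\<And>s. s \<in> S \<Longrightarrow> s \<otimes> s = \<one>" "x \<in> generate G S"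
  shows "\<exists>ws. set ws \<subseteq> S \<and> x = word_prod ws"
  using assms(3)
proof induction
  case one
  show ?case by (intro exI[of _ "[]"]) simp
next
  case (incl h)
  then show ?case using assms(1) by (intro exI[of _ "[h]"]) auto
next
  case (inv h)
  then have "inv h = h" using assms(1,2) by (intro inv_equality) auto
  then show ?case using inv assms(1) by (intro exI[of _ "[h]"]) auto
next
  case (eng g h)
  then obtain xs ys where *: "set xs \<subseteq> S" "g = word_prod xs" "set ys \<subseteq> S" "h = word_prod ys" by blast
  then have "word_prod (xs @ ys) = g \<otimes> h"
    using word_prod_append[of xs ys] assms(1) by (simp del: foldr_append)
  then show ?case using * by (metis Un_least set_append)
qed

lemma word_length_le: "set ws \<subseteq> S \<Longrightarrow> word_length G S (word_prod ws) \<le> length ws"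
  unfolding word_length_def by (rule Least_le) auto

context
  fixes S
  assumes S: "S \<subseteq> carrier G" "finite S" and invol: "\<And>s. s \<in> S \<Longrightarrow> s \<otimes> s = \<one>"
begin

lemma sphere_subset_words:
  "{x \<in> generate G S. word_length G S x = k} \<subseteq> word_prod ` {ws. set ws \<subseteq> S \<and> length ws = k}"
proof
  fix x assume x: "x \<in> {x \<in> generate G S. word_length G S x = k}"
  then obtain ws where "set ws \<subseteq> S" "x = word_prod ws"
    using generate_involutions_word[OF S(1) invol] by blast
  then have "\<exists>k ws. length ws = k \<and> set ws \<subseteq> S \<and> x = word_prod ws" by blast
  then have "\<exists>ws. length ws = word_length G S x \<and> set ws \<subseteq> S \<and> x = word_prod ws"
    unfolding word_length_def by (rule LeastI_ex)
  then show "x \<in> word_prod ` {ws. set ws \<subseteq> S \<and> length ws = k}" using x by auto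
qed

lemma finite_sphere: "finite {x \<in> generate G S. word_length G S x = k}"
  by (rule finite_subset[OF sphere_subset_words]) (simp add: finite_lists_length_eq S(2))

lemma sphere_size_le: "sphere_size G S k \<le> card S ^ k"
proof -
  have fin: "finite {ws. set ws \<subseteq> S \<and> length ws = k}" by (simp add: finite_lists_length_eq S(2))
  have "sphere_size G S k \<le> card (word_prod ` {ws. set ws \<subseteq> S \<and> length ws = k})"
    unfolding sphere_size_def using fin by (intro card_mono sphere_subset_words) simp
  also have "\<dots> \<le> card {ws. set ws \<subseteq> S \<and> length ws = k}" using fin by (rule card_image_le)
  also have "\<dots> = card S ^ k" using S(2) by (rule card_lists_length_eq)
  finally show ?thesis .
qed

text \<open>The sphere of radius \<open>k\<close> has at most \<open>card S ^ k\<close> elements.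
  Finiteness is what allows the rate to belong to a set of reals.\<close>

lemma growth_rate_real: "\<exists>\<tau>. ereal \<tau> = growth_rate G S"
proof -
  have "growth_rate G S \<le> ereal (card S)"
    unfolding growth_rate_def
  proof (intro Limsup_bounded eventually_sequentiallyI[of 1])
    fix k :: nat assume "1 \<le> k"
    then have "root k (sphere_size G S k) \<le> root k (real (card S) ^ k)"
      using sphere_size_le[of k] by (simp flip: of_nat_power)
    then show "ereal (root k (real (sphere_size G S k))) \<le> ereal (real (card S))"
      using \<open>1 \<le> k\<close> by (simp add: real_root_power_cancel)
  qed
  moreover have "0 \<le> growth_rate G S"
    unfolding growth_rate_def by (intro le_Limsup always_eventually) (auto intro: real_root_ge_zero)
  ultimately have "\<bar>growth_rate G S\<bar> \<noteq> \<infinity>" by auto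
  then show ?thesis by (metis ereal_real)
qed

text \<open>If the elements \<open>r i \<otimes> t\<close> generate a free monoid of rank \<open>card I\<close>, then there are at least
  \<open>card I ^ k\<close> elements of word length at most \<open>2 * k\<close>.\<close>

lemma growth_rate_ge_of_free_monoid:
  fixes r :: "'i \<Rightarrow> 'a" and t :: 'a and R :: real
  defines "w \<equiv> \<lambda>xs. word_prod (concat (map (\<lambda>i. [r i, t]) xs))"
  assumes I: "finite I" and R: "R \<ge> 1" "real (card I) > 4 * R\<^sup>2"
    and rS: "\<And>i. i \<in> I \<Longrightarrow> r i \<in> S" and tS: "t \<in> S"
    and inj: "\<And>k. inj_on w {xs. set xs \<subseteq> I \<and> length xs = k}"
  shows "ereal R \<le> growth_rate G S"
proof (rule ccontr)
  assume "\<not> ereal R \<le> growth_rate G S"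
  then have "growth_rate G S < ereal R" by simp
  then have "eventually (\<lambda>k. ereal (root k (real (sphere_size G S k))) < ereal R) sequentially"
    unfolding growth_rate_def by (rule Limsup_lessD)
  then obtain K where K: "\<And>k. k \<ge> K \<Longrightarrow> root k (real (sphere_size G S k)) < R"
    by (auto simp: eventually_sequentially)
  \<comment> \<open>\<open>C\<close> absorbs the finitely many small spheres on which the root bound
    may fail.\<close>
  define C where "C = 1 + (\<Sum>j\<le>K. real (sphere_size G S j))"
  have C: "C \<ge> 1" by (simp add: C_def sum_nonneg)
  have a: "real (sphere_size G S j) \<le> C * R ^ j" for j
  proof (cases "j \<le> K")
    case True
    then have "real (sphere_size G S j) \<le> (\<Sum>j\<le>K. real (sphere_size G S j))"
      by (intro member_le_sum) auto
    then have "real (sphere_size G S j) \<le> C" by (simp add: C_def)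
    also have "\<dots> \<le> C * R ^ j" using C one_le_power[OF R(1), of j] by simp
    finally show ?thesis .
  next
    case False
    then have "root j (real (sphere_size G S j)) < R" "j > 0" using K[of j] by auto
    then have "real (sphere_size G S j) \<le> R ^ j"
      by (metis less_imp_le of_nat_0_le_iff power_mono real_root_ge_zero real_root_pow_pos2)
    also have "\<dots> \<le> C * R ^ j" using C R(1) by simp
    finally show ?thesis .
  qed
  \<comment> \<open>The \<open>card I ^ k\<close> distinct products lie in the ball of radius
    \<open>2 * k\<close>, a union of \<open>2 * k + 1\<close> spheres. Bounding this number by
    \<open>4 ^ k\<close> produces the factor 4 in the hypothesis on \<open>card I\<close>.\<close>
  have bound: "real (card I) ^ k \<le> C * (4 * R\<^sup>2) ^ k" for k
  proof -
    let ?L = "{xs. set xs \<subseteq> I \<and> length xs = k}"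
    have sub: "w ` ?L \<subseteq> (\<Union>j\<le>2 * k. {x \<in> generate G S. word_length G S x = j})"
    proof
      fix x assume "x \<in> w ` ?L"
      then obtain xs where xs: "set xs \<subseteq> I" "length xs = k" "x = w xs" by auto
      define ws where "ws = concat (map (\<lambda>i. [r i, t]) xs)"
      have "length ws = 2 * length xs" unfolding ws_def by (induction xs) auto
      moreover have "set ws \<subseteq> S" using xs(1) rS tS by (auto simp: ws_def)
      moreover have "x = word_prod ws" using xs(3) by (simp add: w_def ws_def)
      ultimately show "x \<in> (\<Union>j\<le>2 * k. {x \<in> generate G S. word_length G S x = j})"
        using word_length_le[of ws S] word_prod_in_generate[of ws S] xs(2) by auto
    qed
    have "card I ^ k = card (w ` ?L)"
      using card_lists_length_eq[OF I] card_image[OF inj] by metis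
    also have "\<dots> \<le> card (\<Union>j\<le>2 * k. {x \<in> generate G S. word_length G S x = j})"
      using finite_sphere by (intro card_mono[OF _ sub]) auto
    also have "\<dots> \<le> (\<Sum>j\<le>2 * k. sphere_size G S j)"
      unfolding sphere_size_def by (rule card_UN_le) simp
    finally have "real (card I ^ k) \<le> real (\<Sum>j\<le>2 * k. sphere_size G S j)" by (rule of_nat_mono)
    then have "real (card I) ^ k \<le> (\<Sum>j\<le>2 * k. real (sphere_size G S j))" by simp
    also have "\<dots> \<le> (\<Sum>j\<le>2 * k. C * R ^ (2 * k))"
    proof (rule sum_mono)
      fix j assume "j \<in> {..2 * k}"
      then have "R ^ j \<le> R ^ (2 * k)" using R(1) by (intro power_increasing) auto
      then show "real (sphere_size G S j) \<le> C * R ^ (2 * k)"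
        using a[of j] C by (meson mult_left_mono order_trans zero_le_one)
    qed
    also have "\<dots> = real (2 * k + 1) * (C * R ^ (2 * k))" by simp
    also have "\<dots> \<le> 4 ^ k * (C * R ^ (2 * k))"
    proof (rule mult_right_mono)
      have "2 * k + 1 \<le> 4 ^ k" by (induction k) auto
      then show "real (2 * k + 1) \<le> 4 ^ k" by (metis of_nat_mono of_nat_numeral of_nat_power)
    qed (use C R in auto)
    finally show ?thesis by (simp add: power_mult_distrib power_mult mult.left_commute)
  qed
  have "real (card I) / (4 * R\<^sup>2) > 1" using R by (simp add: field_simps)
  then obtain k where "C < (real (card I) / (4 * R\<^sup>2)) ^ k" using real_arch_pow by blast
  then have "C * (4 * R\<^sup>2) ^ k < real (card I) ^ k"
    using R(1) by (simp add: power_divide pos_less_divide_eq)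
  then show False using bound[of k] by simp
qed

end

end

section \<open>Words in reflections acting on \<open>H3\<close>\<close>

lemma BijGroup_mult_apply:
  assumes "f \<in> carrier (BijGroup X)" "g \<in> carrier (BijGroup X)" "x \<in> X"
  shows "(f \<otimes>\<^bsub>BijGroup X\<^esub> g) x = f (g x)"
  using assms by (simp add: BijGroup_def compose_def)

lemma BijGroup_word_apply:
  assumes "set ws \<subseteq> carrier (BijGroup X)" "x \<in> X"
  shows "foldr (\<otimes>\<^bsub>BijGroup X\<^esub>) ws \<one>\<^bsub>BijGroup X\<^esub> x = foldr (\<lambda>f. f) ws x"
  using assms
proof (induction ws)
  case Nil
  then show ?case by (simp add: BijGroup_def)
next
  case (Cons f ws)
  interpret group "BijGroup X" by (rule group_BijGroup)
  have "word_prod ws \<in> carrier (BijGroup X)" using Cons.prems by (intro word_prod_closed) auto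
  then have "(f \<otimes>\<^bsub>BijGroup X\<^esub> word_prod ws) x = f (word_prod ws x)"
    using Cons.prems by (intro BijGroup_mult_apply) auto
  then show ?case using Cons.IH Cons.prems by simp
qed

lemma hyp_reflection_in_carrier:
  assumes "spacelike u"
  shows "hyp_reflection u \<in> carrier (BijGroup H3)"
  unfolding BijGroup_def Bij_def partial_object.simps
  by (intro IntI CollectI bij_betw_byWitness[where f' = "hyp_reflection u"])
     (auto simp: hyp_reflection_involution hyp_reflection_in_H3 assms,
      simp add: hyp_reflection_def extensional_def)

lemma hyp_reflection_square:
  assumes "spacelike u"
  shows "hyp_reflection u \<otimes>\<^bsub>BijGroup H3\<^esub> hyp_reflection u = \<one>\<^bsub>BijGroup H3\<^esub>"
  using hyp_reflection_in_carrier[OF assms] hyp_reflection_involution[OF assms]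
  by (auto simp: BijGroup_def compose_def intro!: restrict_ext)

text \<open>The linear reflection negates the product with \<open>u\<close>; rescaling the last
  coordinate to 1 only multiplies by a positive \<open>s\<close>.\<close>

lemma lorentz_hyp_reflection_pos:
  assumes "spacelike u" "x \<in> H3" "lorentz u (x, 1) < 0"
  shows "lorentz u (hyp_reflection u x, 1) > 0"
proof -
  obtain s where s: "s > 0"
    "(hyp_reflection u x, 1) = s *\<^sub>R ((x, 1) - (2 * lorentz u (x, 1) / lorentz u u) *\<^sub>R u)"
    using hyp_reflection_lift[OF assms(1,2)] .
  have nz: "lorentz u u \<noteq> 0" using assms(1) by (simp add: spacelike_def)
  have "lorentz (1 *\<^sub>R u) (hyp_reflection u x, 1) =
      s * (lorentz u (x, 1) - 2 * lorentz u (x, 1) / lorentz u u * lorentz u u)"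
    unfolding s(2) lorentz_scale lorentz_diff_scale by simp
  also have "\<dots> = s * (- lorentz u (x, 1))" using nz by simp
  also have "\<dots> > 0" using s(1) assms(3) by (intro mult_pos_pos) auto
  finally show ?thesis by simp
qed

text \<open>Ping-pong: \<open>r i\<close> composed with the reflection in \<open>v\<close> maps the negative side of \<open>v\<close> into the
  positive side of \<open>u i\<close>, and these positive sides are disjoint.\<close>

lemma reflections_free_monoid:
  fixes u :: "'i \<Rightarrow> (real^3) \<times> real"
  defines "r \<equiv> \<lambda>i. hyp_reflection (u i)"
  assumes sp: "\<And>i. i \<in> I \<Longrightarrow> spacelike (u i)" "spacelike v"
    and disj: "\<And>i j x. i \<in> I \<Longrightarrow> j \<in> I \<Longrightarrow> i \<noteq> j \<Longrightarrow> x \<in> H3 \<Longrightarrow>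
        lorentz (u i) (x, 1) > 0 \<Longrightarrow> lorentz (u j) (x, 1) \<le> 0"
    and disj_v: "\<And>i x. i \<in> I \<Longrightarrow> x \<in> H3 \<Longrightarrow> lorentz (u i) (x, 1) > 0 \<Longrightarrow> lorentz v (x, 1) < 0"
      "\<And>i x. i \<in> I \<Longrightarrow> x \<in> H3 \<Longrightarrow> lorentz v (x, 1) > 0 \<Longrightarrow> lorentz (u i) (x, 1) < 0"
    and p: "p \<in> H3" "lorentz v (p, 1) < 0"
  shows "inj_on (\<lambda>xs. foldr (\<otimes>\<^bsub>BijGroup H3\<^esub>) (concat (map (\<lambda>i. [r i, hyp_reflection v]) xs)) \<one>\<^bsub>BijGroup H3\<^esub>)
           {xs. set xs \<subseteq> I \<and> length xs = k}"
proof -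
  let ?W = "\<lambda>xs. concat (map (\<lambda>i. [r i, hyp_reflection v]) xs)"
  \<comment> \<open>Distinct words are already separated by where they send the single point
    \<open>p\<close>.\<close>
  define w where "w xs = foldr (\<lambda>i x. r i (hyp_reflection v x)) xs p" for xs
  have w_eq: "foldr (\<otimes>\<^bsub>BijGroup H3\<^esub>) (?W xs) \<one>\<^bsub>BijGroup H3\<^esub> p = w xs" if "set xs \<subseteq> I" for xs
  proof -
    have "set (?W xs) \<subseteq> carrier (BijGroup H3)"
      using that by (auto simp: r_def intro!: hyp_reflection_in_carrier sp)
    then have "foldr (\<otimes>\<^bsub>BijGroup H3\<^esub>) (?W xs) \<one>\<^bsub>BijGroup H3\<^esub> p = foldr (\<lambda>f. f) (?W xs) p"
      using p(1) by (rule BijGroup_word_apply)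
    also have "\<dots> = w xs" unfolding w_def by (induction xs) auto
    finally show ?thesis .
  qed
  have step: "r i (hyp_reflection v x) \<in> H3 \<and> lorentz (u i) (r i (hyp_reflection v x), 1) > 0"
    if "i \<in> I" "x \<in> H3" "lorentz v (x, 1) < 0" for i x
    using that sp disj_v(2) unfolding r_def
    by (meson hyp_reflection_in_H3 lorentz_hyp_reflection_pos)
  have inv: "w xs \<in> H3 \<and> lorentz v (w xs, 1) < 0" if "set xs \<subseteq> I" for xs
    using that
  proof (induction xs)
    case (Cons i xs)
    then show ?case using step[of i "w xs"] disj_v(1) by (auto simp: w_def)
  qed (use p in \<open>simp add: w_def\<close>)
  have inj: "xs = ys" if "length xs = length ys" "set xs \<subseteq> I" "set ys \<subseteq> I" "w xs = w ys" for xs ys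
    using that
  proof (induction xs ys rule: list_induct2)
    case (Cons i xs j ys)
    have wc: "w (l # ls) = r l (hyp_reflection v (w ls))" for l ls by (simp add: w_def)
    have ij: "i \<in> I" "j \<in> I" using Cons.prems by auto
    note A = inv[of xs] inv[of ys]
    \<comment> \<open>The common image lies on the positive sides of both \<open>u i\<close> and
      \<open>u j\<close>, which are disjoint for distinct indices. So the first letters agree and
      can be cancelled.\<close>
    have "lorentz (u i) (w (i # xs), 1) > 0" "lorentz (u j) (w (i # xs), 1) > 0" "w (i # xs) \<in> H3"
      using step[OF ij(1), of "w xs"] step[OF ij(2), of "w ys"] A Cons.prems by (auto simp: wc)
    then have [simp]: "i = j" using disj[OF ij] by force
    have "hyp_reflection v (w xs) = hyp_reflection v (w ys)"
      using Cons.prems A sp ij unfolding wc r_def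
      by (metis (full_types) \<open>i = j\<close> hyp_reflection_in_H3 hyp_reflection_involution list.set_intros(2) subset_code(1))
    then have "w xs = w ys"
      using Cons.prems A sp by (metis hyp_reflection_involution list.set_intros(2) subset_code(1))
    then show ?case using Cons by auto
  qed simp
  show ?thesis
  proof (rule inj_onI)
    fix xs ys
    assume *: "xs \<in> {xs. set xs \<subseteq> I \<and> length xs = k}" "ys \<in> {xs. set xs \<subseteq> I \<and> length xs = k}"
      and eq: "foldr (\<otimes>\<^bsub>BijGroup H3\<^esub>) (?W xs) \<one>\<^bsub>BijGroup H3\<^esub> = foldr (\<otimes>\<^bsub>BijGroup H3\<^esub>) (?W ys) \<one>\<^bsub>BijGroup H3\<^esub>"
    then have "w xs = w ys" using w_eq[of xs] w_eq[of ys] by simp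
    then show "xs = ys" using inj * by simp
  qed
qed

section \<open>Polytopes given by half-spaces\<close>

lemma lorentz_commute: "lorentz u v = lorentz v u"
  by (simp add: lorentz_def inner_commute)

lemma lorentz_scale_left: "lorentz (c *\<^sub>R u) v = c * lorentz u v"
  using lorentz_scale[of c u 1 v] by simp

lemma lorentz_scale_right: "lorentz u (c *\<^sub>R v) = c * lorentz u v"
  using lorentz_scale[of 1 u c v] by simp

lemma hyp_plane_scale: "c \<noteq> 0 \<Longrightarrow> hyp_plane (c *\<^sub>R u) = hyp_plane u"
  by (simp add: hyp_plane_def lorentz_scale_left)

lemma hyp_reflection_scale:
  assumes "c \<noteq> 0"
  shows "hyp_reflection (c *\<^sub>R u) = hyp_reflection u"
proof -
  have "(2 * lorentz (c *\<^sub>R u) w / lorentz (c *\<^sub>R u) (c *\<^sub>R u)) *\<^sub>R (c *\<^sub>R u)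
      = (2 * lorentz u w / lorentz u u) *\<^sub>R u" for w
    using assms by (simp add: lorentz_scale_left lorentz_scale_right)
  then show ?thesis by (simp only: hyp_reflection_def)
qed

lemma dihedral_angle_scale:
  assumes "c > 0" "d > 0"
  shows "dihedral_angle (c *\<^sub>R u) (d *\<^sub>R v) = dihedral_angle u v"
proof -
  have "sqrt ((c * c * p) * (d * d * q)) = c * d * sqrt (p * q)" for p q
  proof -
    have "(c * c * p) * (d * d * q) = (c * d)\<^sup>2 * (p * q)" by (simp add: power2_eq_square)
    then show ?thesis using assms by (simp add: real_sqrt_mult)
  qed
  then show ?thesis
    using assms by (simp add: dihedral_angle_def lorentz_scale)
qed

lemma dihedral_angle_commute: "dihedral_angle u v = dihedral_angle v u"
  by (simp add: dihedral_angle_def lorentz_commute[of v u] mult.commute)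

text \<open>Strict inequalities at explicit points serve as certificates: \<open>q\<close> for a
  nonempty interior, \<open>facet_point\<close> for irredundancy, that is, every half-space
  contributes a facet.\<close>

locale halfspace_family =
  fixes N :: "((real^3) \<times> real) set" and P :: "(real^3) set" and q :: "real^3"
  assumes finite: "finite N"
    and spacelike: "u \<in> N \<Longrightarrow> spacelike u"
    and P: "P = H3 \<inter> (\<Inter>u\<in>N. hyp_halfspace u)"
    and q: "q \<in> H3" "u \<in> N \<Longrightarrow> lorentz u (q, 1) < 0"
    and facet_point: "u \<in> N \<Longrightarrow> \<exists>x\<in>hyp_plane u. \<forall>v\<in>N - {u}. lorentz v (x, 1) < 0"
begin

lemma interior_nonempty: "interior P \<noteq> {}"
proof -
  obtain e where "e > 0" "ball q e \<subseteq> P"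
    using strict_halfspaces_contain_ball[OF finite q] unfolding P by blast
  then have "q \<in> interior P" by (auto simp: mem_interior)
  then show ?thesis by blast
qed

lemma polygon: "u \<in> N \<Longrightarrow> hyp_polygon u (P \<inter> hyp_plane u)"
  using facet_point[of u] hyp_polygon_of_point[OF finite spacelike] unfolding P by blast

lemma facet_normal: "u \<in> N \<Longrightarrow> facet_normal P u"
  using polygon spacelike P by (auto simp: facet_normal_def)

lemma facet_normalE:
  assumes "facet_normal P u"
  obtains v c where "v \<in> N" "c > 0" "u = c *\<^sub>R v"
  using facet_normal_multiple[OF finite spacelike P interior_nonempty assms] by blast

lemma facet_reflections: "facet_reflections P = hyp_reflection ` N"
proof
  show "facet_reflections P \<subseteq> hyp_reflection ` N"
  proof
    fix r assume "r \<in> facet_reflections P"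
    then obtain u where u: "facet_normal P u" "r = hyp_reflection u" by (auto simp: facet_reflections_def)
    then obtain v c where "v \<in> N" "c > 0" "u = c *\<^sub>R v" using facet_normalE by blast
    then show "r \<in> hyp_reflection ` N" using u by (simp add: hyp_reflection_scale)
  qed
  show "hyp_reflection ` N \<subseteq> facet_reflections P"
    using facet_normal by (auto simp: facet_reflections_def)
qed

lemma ideal_polytope:
  assumes V: "finite V" "V \<subseteq> ideal_points" "P = H3 \<inter> convex hull V"
  shows "ideal_polytope P"
proof -
  have "P = H3 \<inter> (\<Inter>u\<in>N. {x. fst u \<bullet> x \<le> snd u})"
    by (auto simp: P hyp_halfspace_def lorentz_point)
  moreover have "closed (\<Inter>u\<in>N. {x. fst u \<bullet> x \<le> snd u})"
    by (intro closed_INT) (auto simp: closed_halfspace_le)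
  ultimately have "closedin (top_of_set H3) P" by (simp add: closedin_closed_Int)
  moreover have "hyp_volume P < \<infinity>"
    using hyp_volume_ideal_hull_finite[OF V(1,2)] V(3) by simp
  ultimately have "hyp_polytope P"
    unfolding hyp_polytope_def
    using interior_nonempty finite spacelike polygon P by blast
  then show ?thesis unfolding ideal_polytope_def using V by blast
qed

text \<open>An intersection of dimension 1 is nonempty, so the planes meet, and it is not a whole
  facet, so the normals come from different members of \<open>N\<close>. Angles are invariant under
  positive scaling.\<close>

lemma coxeter_polytope:
  assumes "hyp_polytope P"
    and angle: "\<And>u v. u \<in> N \<Longrightarrow> v \<in> N \<Longrightarrow> u \<noteq> v \<Longrightarrow> hyp_plane u \<inter> hyp_plane v \<noteq> {} \<Longrightarrow>
      \<exists>k::nat. k \<ge> 2 \<and> dihedral_angle u v = pi / real k"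
  shows "coxeter_polytope P"
  unfolding coxeter_polytope_def
proof (intro conjI allI impI; (elim conjE)?)
  fix u v
  assume u: "facet_normal P u" and v: "facet_normal P v"
    and dim: "aff_dim ((P \<inter> hyp_plane u) \<inter> (P \<inter> hyp_plane v)) = 1"
  obtain a c where a: "a \<in> N" "c > 0" "u = c *\<^sub>R a" using facet_normalE[OF u] .
  obtain b d where b: "b \<in> N" "d > 0" "v = d *\<^sub>R b" using facet_normalE[OF v] .
  have planes: "hyp_plane u = hyp_plane a" "hyp_plane v = hyp_plane b"
    using a b by (simp_all add: hyp_plane_scale)
  have "a \<noteq> b"
  proof
    assume "a = b"
    then have "aff_dim (P \<inter> hyp_plane a) = 1" using dim planes by simp
    then show False using aff_dim_hyp_polygon[OF spacelike polygon] a(1) by fastforce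
  qed
  moreover have "hyp_plane a \<inter> hyp_plane b \<noteq> {}"
  proof
    assume "hyp_plane a \<inter> hyp_plane b = {}"
    then have "(P \<inter> hyp_plane u) \<inter> (P \<inter> hyp_plane v) = {}" using planes by blast
    then show False using dim by simp
  qed
  ultimately show "\<exists>k::nat. k \<ge> 2 \<and> dihedral_angle u v = pi / real k"
    using angle[OF a(1) b(1)] a b by (simp add: dihedral_angle_scale)
qed (rule assms(1))

end

section \<open>A row of ideal square pyramids\<close>

lemma H3_iff: "x \<in> H3 \<longleftrightarrow> (x$1)\<^sup>2 + (x$2)\<^sup>2 + (x$3)\<^sup>2 < 1"
  by (simp add: H3_def norm_lt_square inner_vec_def sum_3 power2_eq_square)

text \<open>The point of the ball with upper half-space coordinates \<open>(x, y, h)\<close>, where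
  \<open>s = x\<^sup>2 + y\<^sup>2 + h\<^sup>2\<close>; geodesic planes become affine planes in \<open>(x, y, s)\<close>.\<close>

definition para :: "real \<Rightarrow> real \<Rightarrow> real \<Rightarrow> real^3" where
  "para x y s = vector [2 * x / (s + 1), 2 * y / (s + 1), (s - 1) / (s + 1)]"

lemma lorentz_para:
  assumes "s + 1 > 0"
  shows "lorentz (vector [a, b, c], d) (para x y s, 1)
    = (2 * a * x + 2 * b * y + c * (s - 1) - d * (s + 1)) / (s + 1)"
proof -
  define S where "S = s + 1"
  have "S > 0" using assms by (simp add: S_def)
  then show ?thesis
    unfolding para_def S_def[symmetric] by (simp add: lorentz_point inner_vec_def sum_3 field_simps)
qed

lemma para_norm:
  assumes "s + 1 > 0"
  shows "1 - ((para x y s $ 1)\<^sup>2 + (para x y s $ 2)\<^sup>2 + (para x y s $ 3)\<^sup>2)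
    = 4 * (s - x\<^sup>2 - y\<^sup>2) / (s + 1)\<^sup>2"
proof -
  have key: "(s + 1)\<^sup>2 - ((2 * x)\<^sup>2 + (2 * y)\<^sup>2 + (s - 1)\<^sup>2) = 4 * (s - x\<^sup>2 - y\<^sup>2)"
    by (simp add: power2_eq_square algebra_simps)
  have "1 - ((para x y s $ 1)\<^sup>2 + (para x y s $ 2)\<^sup>2 + (para x y s $ 3)\<^sup>2)
      = 1 - ((2 * x)\<^sup>2 + (2 * y)\<^sup>2 + (s - 1)\<^sup>2) / (s + 1)\<^sup>2"
    unfolding para_def vector_3 power_divide by (simp only: add_divide_distrib)
  also have "\<dots> = ((s + 1)\<^sup>2 - ((2 * x)\<^sup>2 + (2 * y)\<^sup>2 + (s - 1)\<^sup>2)) / (s + 1)\<^sup>2"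
    using assms by (simp add: diff_divide_distrib)
  finally show ?thesis by (simp only: key)
qed

lemma para_in_H3:
  assumes "x\<^sup>2 + y\<^sup>2 < s"
  shows "para x y s \<in> H3"
proof -
  have "s > 0" using assms by (smt (verit) zero_le_power2)
  then have "4 * (s - x\<^sup>2 - y\<^sup>2) / (s + 1)\<^sup>2 > 0" using assms by simp
  then show ?thesis using para_norm[of s x y] \<open>s > 0\<close> by (simp add: H3_iff)
qed

lemma para_ideal: "para x y (x\<^sup>2 + y\<^sup>2) \<in> ideal_points"
proof -
  have "x\<^sup>2 + y\<^sup>2 + 1 > 0" by (smt (verit) zero_le_power2)
  from para_norm[OF this, of x y] have "para x y (x\<^sup>2 + y\<^sup>2) \<bullet> para x y (x\<^sup>2 + y\<^sup>2) = 1"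
    by (simp add: inner_vec_def sum_3 power2_eq_square)
  then show ?thesis by (simp add: ideal_points_def norm_eq_1)
qed

lemma H3_paraE:
  assumes "p \<in> H3"
  obtains x y s where "p = para x y s" "x\<^sup>2 + y\<^sup>2 < s" "s > 0"
proof -
  have sq: "(p$1)\<^sup>2 + (p$2)\<^sup>2 + (p$3)\<^sup>2 < 1" using assms by (simp add: H3_iff)
  then have "(p$3)\<^sup>2 < 1" by (smt (verit) zero_le_power2)
  then have w: "1 - p$3 > 0" by (simp add: abs_square_less_1)
  \<comment> \<open>These formulas invert \<open>para\<close>: the third coordinate determines
    \<open>s\<close>, with \<open>s + 1 = 2 / (1 - p$3)\<close>, and then the others give
    \<open>x\<close> and \<open>y\<close>.\<close>
  define x y s where "x = p$1 / (1 - p$3)" and "y = p$2 / (1 - p$3)" and "s = (1 + p$3) / (1 - p$3)"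
  have s1: "s + 1 = 2 / (1 - p$3)" using w by (simp add: s_def field_simps)
  then have s0: "s + 1 > 0" using w by simp
  have p: "p = para x y s"
    unfolding para_def s1 using w
    by (simp add: vec_eq_iff forall_3 x_def y_def s_def field_simps)
  have "0 < 4 * (s - x\<^sup>2 - y\<^sup>2) / (s + 1)\<^sup>2"
    using sq para_norm[OF s0, of x y] by (simp flip: p)
  then have "x\<^sup>2 + y\<^sup>2 < s" using s0 by (simp add: zero_less_divide_iff)
  moreover from this have "s > 0" by (smt (verit) zero_le_power2)
  ultimately show ?thesis using that p by blast
qed

text \<open>In upper half-space coordinates the polytope lies over the rectangle \<open>[0, n] \<times> [0, 1]\<close>, with
  the hemisphere \<open>cap i\<close> circumscribed about the unit square \<open>[i, i + 1] \<times> [0, 1]\<close>; in \<open>(x, y, s)\<close> the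
  hemisphere is the plane \<open>s = (2 * i + 1) * x + y - i * (i + 1)\<close>. All normals point outwards.\<close>

definition wall_left :: "(real^3) \<times> real" where
  "wall_left = (vector [-1, 0, 0], 0)"

definition wall_right :: "nat \<Rightarrow> (real^3) \<times> real" where
  "wall_right n = (vector [1, 0, real n], real n)"

definition wall_front :: "(real^3) \<times> real" where
  "wall_front = (vector [0, -1, 0], 0)"

definition wall_back :: "(real^3) \<times> real" where
  "wall_back = (vector [0, 1, 1], 1)"

definition cap :: "nat \<Rightarrow> (real^3) \<times> real" where
  "cap i = (vector [2 * real i + 1, 1, real i * (real i + 1) - 1], real i * (real i + 1) + 1)"

definition normals :: "nat \<Rightarrow> ((real^3) \<times> real) set" where
  "normals n = {wall_left, wall_right n, wall_front, wall_back} \<union> cap ` {..<n}"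

definition chain :: "nat \<Rightarrow> (real^3) set" where
  "chain n = H3 \<inter> (\<Inter>u\<in>normals n. hyp_halfspace u)"

text \<open>The first point represents infinity, the common apex of the pyramids. The others are the
  lattice points of the rectangle at height 0, where
  \<open>s = x\<^sup>2 + y\<^sup>2\<close>.\<close>

definition chain_vertices :: "nat \<Rightarrow> (real^3) set" where
  "chain_vertices n = insert (vector [0, 0, 1])
     ((\<lambda>(i, j). para (real i) (real j) ((real i)\<^sup>2 + (real j)\<^sup>2)) ` ({..n} \<times> {0, 1}))"

section \<open>The normals of the row in upper half-space coordinates\<close>

lemma lorentz_products:
  "lorentz wall_left wall_left = 1" "lorentz (wall_right n) (wall_right n) = 1"
  "lorentz wall_front wall_front = 1" "lorentz wall_back wall_back = 1"
  "lorentz (cap i) (cap i) = 2"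
  "lorentz wall_left wall_front = 0" "lorentz wall_left wall_back = 0"
  "lorentz (wall_right n) wall_front = 0" "lorentz (wall_right n) wall_back = 0"
  "lorentz wall_front (cap i) = -1" "lorentz wall_back (cap i) = -1"
  "lorentz wall_left (cap i) = - (2 * real i + 1)"
  "lorentz (wall_right n) (cap i) = 2 * real i + 1 - 2 * real n"
  "lorentz (cap i) (cap j) = 2 - 2 * (real i - real j)\<^sup>2"
  by (simp_all add: lorentz_def wall_left_def wall_right_def wall_front_def wall_back_def cap_def
      inner_vec_def sum_3 power2_eq_square algebra_simps)

lemma lorentz_normals_para:
  assumes "s + 1 > 0"
  shows "lorentz wall_left (para x y s, 1) = - 2 * x / (s + 1)"
    "lorentz (wall_right n) (para x y s, 1) = 2 * (x - real n) / (s + 1)"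
    "lorentz wall_front (para x y s, 1) = - 2 * y / (s + 1)"
    "lorentz wall_back (para x y s, 1) = 2 * (y - 1) / (s + 1)"
    "lorentz (cap i) (para x y s, 1)
      = 2 * ((2 * real i + 1) * x + y - real i * (real i + 1) - s) / (s + 1)"
  unfolding wall_left_def wall_right_def wall_front_def wall_back_def cap_def lorentz_para[OF assms]
  by (simp_all add: algebra_simps)

lemma lorentz_normals_para_neg:
  assumes "s + 1 > 0"
  shows "lorentz wall_left (para x y s, 1) < 0 \<longleftrightarrow> x > 0"
    "lorentz (wall_right n) (para x y s, 1) < 0 \<longleftrightarrow> x < real n"
    "lorentz wall_front (para x y s, 1) < 0 \<longleftrightarrow> y > 0"
    "lorentz wall_back (para x y s, 1) < 0 \<longleftrightarrow> y < 1"
    "lorentz (cap i) (para x y s, 1) < 0 \<longleftrightarrow> (2 * real i + 1) * x + y - real i * (real i + 1) < s"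
  unfolding lorentz_normals_para[OF assms] using assms
  by (auto simp: divide_less_0_iff zero_less_divide_iff mult_less_0_iff zero_less_mult_iff)

lemma lorentz_normals_para_zero:
  assumes "s + 1 > 0"
  shows "lorentz wall_left (para x y s, 1) = 0 \<longleftrightarrow> x = 0"
    "lorentz (wall_right n) (para x y s, 1) = 0 \<longleftrightarrow> x = real n"
    "lorentz wall_front (para x y s, 1) = 0 \<longleftrightarrow> y = 0"
    "lorentz wall_back (para x y s, 1) = 0 \<longleftrightarrow> y = 1"
    "lorentz (cap i) (para x y s, 1) = 0 \<longleftrightarrow> (2 * real i + 1) * x + y - real i * (real i + 1) = s"
  unfolding lorentz_normals_para[OF assms] using assms by auto

text \<open>Complete the square about the centre \<open>(i + 1 / 2, 1 / 2)\<close>: a point on or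
  below the hemisphere lies over a disc of squared radius 1/2. The weaker bound 1 suffices to
  separate centres at distance 2 or more, and centres from walls at distance 3/2 or more.\<close>

lemma cap_shadow:
  assumes "x\<^sup>2 + y\<^sup>2 < s" "(2 * real i + 1) * x + y - real i * (real i + 1) \<ge> s"
  shows "\<bar>x - real i - 1 / 2\<bar> < 1"
proof -
  have "(x - real i - 1 / 2)\<^sup>2 + (y - 1 / 2)\<^sup>2
      = x\<^sup>2 + y\<^sup>2 - ((2 * real i + 1) * x + y - real i * (real i + 1)) + 1 / 2"
    by (simp add: power2_eq_square algebra_simps)
  then have "(x - real i - 1 / 2)\<^sup>2 + (y - 1 / 2)\<^sup>2 < 1" using assms by linarith
  then have "(x - real i - 1 / 2)\<^sup>2 < 1" by (smt (verit) zero_le_power2)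
  then show ?thesis by (simp add: abs_square_less_1)
qed

text \<open>Even indices put the centres at distance at least 2, so the shadows are disjoint already
  in the \<open>x\<close> coordinate.\<close>

lemma cap_positive_sides_disjoint:
  assumes "p \<in> H3" "lorentz (cap (2 * i)) (p, 1) > 0" "i \<noteq> j"
  shows "lorentz (cap (2 * j)) (p, 1) < 0"
proof (rule ccontr)
  assume *: "\<not> lorentz (cap (2 * j)) (p, 1) < 0"
  obtain x y s where p: "p = para x y s" "x\<^sup>2 + y\<^sup>2 < s" "s > 0" using H3_paraE[OF assms(1)] .
  have s: "s + 1 > 0" using p by simp
  have "\<bar>x - real (2 * i) - 1 / 2\<bar> < 1"
    using assms(2) lorentz_normals_para_neg(5)[OF s, of "2 * i" x y] unfolding p(1)
    by (intro cap_shadow[OF p(2)]) linarith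
  moreover have "\<bar>x - real (2 * j) - 1 / 2\<bar> < 1"
    using * lorentz_normals_para_neg(5)[OF s, of "2 * j" x y] unfolding p(1)
    by (intro cap_shadow[OF p(2)]) linarith
  ultimately have "\<bar>real i - real j\<bar> < 1"
    unfolding of_nat_mult of_nat_numeral by linarith
  then show False using assms(3) by linarith
qed

lemma consecutive_product_nonneg: "(z::int) * (z + 1) \<ge> 0"
  by (cases "z \<ge> 0") (auto simp: zero_le_mult_iff)

text \<open>The difference of the two sides is \<open>(k - i) * (k - i - 1)\<close>, a product of
  consecutive integers. Geometrically, no lattice vertex lies strictly inside a hemisphere.\<close>

lemma square_ge_chord: "(2 * real i + 1) * real k - real i * (real i + 1) \<le> (real k)\<^sup>2"
proof -
  have "real_of_int ((int i - int k) * ((int i - int k) + 1)) \<ge> 0"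
    using consecutive_product_nonneg[of "int i - int k"] by linarith
  then show ?thesis by (simp add: power2_eq_square algebra_simps)
qed

text \<open>On a wall the witness lies over an interior point of its side of the rectangle, with
  \<open>s\<close> large enough to be above every hemisphere. On \<open>cap k\<close> it is the top
  of the hemisphere.\<close>

lemma normals_facet_point:
  assumes "n > 0" "u \<in> normals n"
  shows "\<exists>x\<in>hyp_plane u. \<forall>v\<in>normals n - {u}. lorentz v (x, 1) < 0"
proof -
  have one: "real n \<ge> 1" using assms(1) by simp
  have half: "(2 * real i + 1) * (1 / 2) - real i * (real i + 1) \<le> 1 / 2" for i
    by (simp add: algebra_simps)
  consider "u = wall_left" | "u = wall_right n" | "u = wall_front" | "u = wall_back" |
    k where "u = cap k" "k < n"
    using assms(2) by (auto simp: normals_def)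
  then show ?thesis
  proof cases
    case 1
    have "para 0 (1 / 2) 1 \<in> hyp_plane wall_left"
      by (simp add: hyp_plane_def para_in_H3 lorentz_normals_para_zero power2_eq_square)
    moreover have "\<forall>v\<in>normals n - {u}. lorentz v (para 0 (1 / 2) 1, 1) < 0"
    proof -
      have s: "1 + 1 > (0::real)" by simp
      have "(2 * real i + 1) * 0 + 1 / 2 - real i * (real i + 1) < 1" for i
        using mult_nonneg_nonneg[of "real i" "real i + 1"] by linarith
      then show ?thesis
        using one 1 by (auto simp: normals_def lorentz_normals_para_neg[OF s])
    qed
    ultimately show ?thesis using 1 by blast
  next
    case 2
    have "para (real n) (1 / 2) ((real n)\<^sup>2 + 1) \<in> hyp_plane (wall_right n)"
      by (simp add: hyp_plane_def para_in_H3 lorentz_normals_para_zero power2_eq_square add_pos_nonneg)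
    moreover have "\<forall>v\<in>normals n - {u}. lorentz v (para (real n) (1 / 2) ((real n)\<^sup>2 + 1), 1) < 0"
    proof -
      have s: "(real n)\<^sup>2 + 1 + 1 > 0" by (smt (verit) zero_le_power2)
      have "(2 * real i + 1) * real n + 1 / 2 - real i * (real i + 1) < (real n)\<^sup>2 + 1" for i
        using square_ge_chord[of i n] by linarith
      then show ?thesis
        using one 2 by (auto simp: normals_def lorentz_normals_para_neg[OF s])
    qed
    ultimately show ?thesis using 2 by blast
  next
    case 3
    have "para (1 / 2) 0 1 \<in> hyp_plane wall_front"
      by (simp add: hyp_plane_def para_in_H3 lorentz_normals_para_zero power2_eq_square)
    moreover have "\<forall>v\<in>normals n - {u}. lorentz v (para (1 / 2) 0 1, 1) < 0"
    proof -
      have s: "1 + 1 > (0::real)" by simp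
      have "(2 * real i + 1) * (1 / 2) + 0 - real i * (real i + 1) < 1" for i
        using half[of i] by linarith
      then show ?thesis
        using one 3 by (auto simp: normals_def lorentz_normals_para_neg[OF s])
    qed
    ultimately show ?thesis using 3 by blast
  next
    case 4
    have "para (1 / 2) 1 2 \<in> hyp_plane wall_back"
      by (simp add: hyp_plane_def para_in_H3 lorentz_normals_para_zero power2_eq_square)
    moreover have "\<forall>v\<in>normals n - {u}. lorentz v (para (1 / 2) 1 2, 1) < 0"
    proof -
      have s: "2 + 1 > (0::real)" by simp
      have "(2 * real i + 1) * (1 / 2) + 1 - real i * (real i + 1) < 2" for i
        using half[of i] by linarith
      then show ?thesis
        using one 4 by (auto simp: normals_def lorentz_normals_para_neg[OF s])
    qed
    ultimately show ?thesis using 4 by blast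
  next
    case 5
    \<comment> \<open>The squared height of this point is
      \<open>s - x\<^sup>2 - 1 / 4 = 1 / 2\<close>, the squared radius. In \<open>s\<close> it
      exceeds the plane of \<open>cap i\<close> by \<open>(i - k)\<^sup>2\<close>.\<close>
    define x s where "x = real k + 1 / 2" and "s = real k * (real k + 1) + 1"
    have s0: "s + 1 > 0" by (simp add: s_def add_pos_nonneg)
    have "x\<^sup>2 + (1 / 2)\<^sup>2 < s" by (simp add: x_def s_def power2_eq_square algebra_simps)
    moreover have "(2 * real k + 1) * x + 1 / 2 - real k * (real k + 1) = s"
      by (simp add: x_def s_def algebra_simps)
    ultimately have "para x (1 / 2) s \<in> hyp_plane (cap k)"
      by (simp add: hyp_plane_def para_in_H3 lorentz_normals_para_zero[OF s0])
    moreover have "\<forall>v\<in>normals n - {u}. lorentz v (para x (1 / 2) s, 1) < 0"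
    proof
      fix v assume v: "v \<in> normals n - {u}"
      have "(2 * real i + 1) * x + 1 / 2 - real i * (real i + 1) < s" if "cap i \<noteq> cap k" for i
      proof -
        have "s - ((2 * real i + 1) * x + 1 / 2 - real i * (real i + 1)) = (real i - real k)\<^sup>2"
          by (simp add: x_def s_def power2_eq_square algebra_simps)
        moreover have "(real i - real k)\<^sup>2 > 0" using that by auto
        ultimately show ?thesis by linarith
      qed
      then have caps: "lorentz (cap i) (para x (1 / 2) s, 1) < 0" if "cap i \<noteq> cap k" for i
        using that by (simp add: lorentz_normals_para_neg[OF s0])
      have "0 < x" "x < real n" using 5(2) by (auto simp: x_def)
      then have walls: "\<forall>v\<in>{wall_left, wall_right n, wall_front, wall_back}.
          lorentz v (para x (1 / 2) s, 1) < 0"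
        by (simp add: lorentz_normals_para_neg[OF s0])
      consider "v \<in> {wall_left, wall_right n, wall_front, wall_back}" |
        i where "v = cap i" "cap i \<noteq> cap k"
        using v 5 unfolding normals_def by blast
      then show "lorentz v (para x (1 / 2) s, 1) < 0"
      proof cases
        case 1
        then show ?thesis using walls by blast
      next
        case (2 i)
        then show ?thesis using caps[of i] by simp
      qed
    qed
    ultimately show ?thesis using 5 by blast
  qed
qed

text \<open>A point over the middle of the first square and above all hemispheres, used both as an
  interior point and as the base point for ping-pong.\<close>

definition center :: "real^3" where
  "center = para (1 / 2) (1 / 2) 2"

lemma center_in_H3: "center \<in> H3"
  by (simp add: center_def para_in_H3 power2_eq_square)

lemma lorentz_cap_center: "lorentz (cap i) (center, 1) < 0"
proof -
  have "(2 * real i + 1) * (1 / 2) + 1 / 2 - real i * (real i + 1) < 2"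
    by (simp add: algebra_simps add_pos_nonneg)
  then show ?thesis by (simp add: center_def lorentz_normals_para_neg)
qed

lemma halfspace_family_chain:
  assumes "n > 0"
  shows "halfspace_family (normals n) (chain n) center"
proof
  show "spacelike u" if "u \<in> normals n" for u
    using that by (auto simp: normals_def spacelike_def lorentz_products)
  show "lorentz u (center, 1) < 0" if "u \<in> normals n" for u
  proof -
    have "1 / 2 < real n" using assms by simp
    then have "lorentz wall_left (center, 1) < 0" "lorentz (wall_right n) (center, 1) < 0"
      "lorentz wall_front (center, 1) < 0" "lorentz wall_back (center, 1) < 0"
      by (simp_all add: center_def lorentz_normals_para_neg)
    then show ?thesis using that lorentz_cap_center by (auto simp: normals_def)
  qed
  show "\<exists>x\<in>hyp_plane u. \<forall>v\<in>normals n - {u}. lorentz v (x, 1) < 0" if "u \<in> normals n" for u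
    using normals_facet_point[OF assms that] .
qed (auto simp: normals_def chain_def center_in_H3)


section \<open>The row as a convex hull of ideal points\<close>

lemma convex_combination5:
  assumes "convex C" "a \<in> C" "b \<in> C" "c \<in> C" "d \<in> C" "e \<in> C"
    and "p \<ge> 0" "q \<ge> 0" "r \<ge> 0" "s \<ge> 0" "t \<ge> 0" "p + q + r + s + t = 1"
  shows "p *\<^sub>R a + q *\<^sub>R b + r *\<^sub>R c + s *\<^sub>R d + t *\<^sub>R e \<in> C"
proof -
  have "(\<Sum>k<5. ([p, q, r, s, t] ! k) *\<^sub>R ([a, b, c, d, e] ! k)) \<in> C"
  proof (rule convex_sum)
    show "(\<Sum>k<5. [p, q, r, s, t] ! k) = 1" using assms by (simp add: eval_nat_numeral)
    fix k :: nat assume "k \<in> {..<5}"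
    then have "k \<in> {0, 1, 2, 3, 4}" by auto
    then show "[p, q, r, s, t] ! k \<ge> 0" "[a, b, c, d, e] ! k \<in> C" using assms by auto
  qed (use assms in auto)
  then show ?thesis by (simp add: eval_nat_numeral)
qed

lemma unit_interval_cover:
  fixes x :: real
  assumes "n > 0" "0 \<le> x" "x \<le> real n"
  obtains i where "i < n" "real i \<le> x" "x \<le> real i + 1"
\<comment> \<open>At the right end \<open>x = n\<close> the floor would be \<open>n\<close>, outside
  the range of indices.\<close>
proof (cases "x < real n")
  case True
  have "real (nat \<lfloor>x\<rfloor>) \<le> x" "x \<le> real (nat \<lfloor>x\<rfloor>) + 1" using assms by linarith+
  moreover have "nat \<lfloor>x\<rfloor> < n" using True assms by linarith
  ultimately show ?thesis using that by blast
next
  case False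
  then have "x = real n" using assms by simp
  then show ?thesis using that[of "n - 1"] assms by (simp add: of_nat_diff)
qed

text \<open>Weighting a point by its denominator \<open>s' + 1\<close> passes to homogeneous
  coordinates, in which combinations are linear in \<open>(x, y, s')\<close>.\<close>

lemma scaled_para:
  assumes "s' + 1 > 0" "t = s' + 1"
  shows "(b * t / S) *\<^sub>R para x y s' = (b / S) *\<^sub>R vector [2 * x, 2 * y, s' - 1]"
  using assms by (simp add: para_def vec_eq_iff forall_3)

text \<open>Over each unit square the point is a bilinear combination of the four vertices above the
  corners, pushed upwards, that is, towards the vertex at infinity \<open>(0, 0, 1)\<close>.\<close>

lemma chain_subset_hull:
  assumes n: "n > 0" and p: "p \<in> chain n"
  shows "p \<in> convex hull (chain_vertices n)"
proof -
  have "p \<in> H3" using p by (simp add: chain_def)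
  then obtain x y s where p_eq: "p = para x y s" "s > 0" by (metis H3_paraE)
  have s0: "s + 1 > 0" using p_eq by simp
  have le: "lorentz u (para x y s, 1) \<le> 0" if "u \<in> normals n" for u
    using p that by (auto simp: chain_def hyp_halfspace_def p_eq)
  have x: "0 \<le> x" "x \<le> real n" and y: "0 \<le> y" "y \<le> 1"
    using le[of wall_left] le[of "wall_right n"] le[of wall_front] le[of wall_back] s0
    unfolding lorentz_normals_para[OF s0]
    by (simp_all add: normals_def divide_le_0_iff zero_le_divide_iff)
  obtain i where i: "i < n" "real i \<le> x" "x \<le> real i + 1"
    using unit_interval_cover[OF n x] .
  \<comment> \<open>The excess of \<open>s\<close> over the plane of \<open>cap i\<close> becomes
    the weight of the apex, up to normalisation by \<open>S\<close>.\<close>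
  define h where "h = s - ((2 * real i + 1) * x + y - real i * (real i + 1))"
  have h: "h \<ge> 0"
    using le[of "cap i"] i(1) s0 unfolding lorentz_normals_para[OF s0]
    by (simp add: normals_def h_def divide_le_0_iff)
  define a where "a = x - real i"
  have a: "0 \<le> a" "a \<le> 1" using i by (auto simp: a_def)
  define V where "V = chain_vertices n"
  define S where "S = s + 1"
  \<comment> \<open>This is the denominator of the vertex over \<open>(k, j)\<close>;
    \<open>j\<close> replaces its square because only 0 and 1 occur.\<close>
  define f where "f k j = real k ^ 2 + j + 1" for k and j :: real
  have f: "f k j > 0" if "j \<ge> 0" for k j using that unfolding f_def by (smt (verit) zero_le_power2)
  have mem: "para (real k) 0 ((real k)\<^sup>2 + 0) \<in> convex hull V"
    "para (real k) 1 ((real k)\<^sup>2 + 1) \<in> convex hull V" if "k \<le> n" for k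
    using that unfolding V_def chain_vertices_def
    by (intro hull_inc insertI2 image_eqI[of _ _ "(k, 0)"] image_eqI[of _ _ "(k, 1)"]; simp)+
  have north: "vector [0, 0, 1] \<in> convex hull V" unfolding V_def chain_vertices_def by (intro hull_inc) simp
  define b00 b10 b01 b11 where "b00 = (1 - a) * (1 - y)" and "b10 = a * (1 - y)"
    and "b01 = (1 - a) * y" and "b11 = a * y"
  have b: "b00 \<ge> 0" "b10 \<ge> 0" "b01 \<ge> 0" "b11 \<ge> 0"
    using a y by (simp_all add: b00_def b10_def b01_def b11_def)
  \<comment> \<open>The four corners lie on the plane of \<open>cap i\<close>, so interpolating
    their values of \<open>s\<close> gives the plane's value at \<open>(x, y)\<close>, and
    \<open>h\<close> makes up the rest.\<close>
  have sums: "b00 + b10 + b01 + b11 = 1"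
    "b00 * real i + b10 * real (Suc i) + b01 * real i + b11 * real (Suc i) = x"
    "b01 + b11 = y"
    "b00 * (f i 0 - 1) + b10 * (f (Suc i) 0 - 1) + b01 * (f i 1 - 1) + b11 * (f (Suc i) 1 - 1) + h = s"
    by (simp_all add: b00_def b10_def b01_def b11_def a_def f_def h_def power2_eq_square algebra_simps)
  have total: "b00 * f i 0 + b10 * f (Suc i) 0 + b01 * f i 1 + b11 * f (Suc i) 1 + h = S"
    using sums(1,4) by (simp add: S_def algebra_simps)
  have "(b00 * f i 0 / S) *\<^sub>R para (real i) 0 ((real i)\<^sup>2 + 0)
      + (b10 * f (Suc i) 0 / S) *\<^sub>R para (real (Suc i)) 0 ((real (Suc i))\<^sup>2 + 0)
      + (b01 * f i 1 / S) *\<^sub>R para (real i) 1 ((real i)\<^sup>2 + 1)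
      + (b11 * f (Suc i) 1 / S) *\<^sub>R para (real (Suc i)) 1 ((real (Suc i))\<^sup>2 + 1)
      + (h / S) *\<^sub>R vector [0, 0, 1] \<in> convex hull V"
  proof (rule convex_combination5)
    show "b00 * f i 0 / S + b10 * f (Suc i) 0 / S + b01 * f i 1 / S + b11 * f (Suc i) 1 / S + h / S = 1"
      using total s0 unfolding add_divide_distrib[symmetric] by (simp add: S_def)
  qed (use b h f[of 0] f[of 1] s0 i(1) mem[of i] mem[of "Suc i"] north in
      \<open>auto simp: S_def less_imp_le intro!: divide_nonneg_pos mult_nonneg_nonneg\<close>)
  also have "(b00 * f i 0 / S) *\<^sub>R para (real i) 0 ((real i)\<^sup>2 + 0)
      + (b10 * f (Suc i) 0 / S) *\<^sub>R para (real (Suc i)) 0 ((real (Suc i))\<^sup>2 + 0)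
      + (b01 * f i 1 / S) *\<^sub>R para (real i) 1 ((real i)\<^sup>2 + 1)
      + (b11 * f (Suc i) 1 / S) *\<^sub>R para (real (Suc i)) 1 ((real (Suc i))\<^sup>2 + 1)
      + (h / S) *\<^sub>R vector [0, 0, 1] = p"
  proof -
    have sc: "(c * f k j / S) *\<^sub>R para (real k) j ((real k)\<^sup>2 + j)
        = (c / S) *\<^sub>R vector [2 * real k, 2 * j, f k j - 2]" if "j \<ge> 0" for c k j
      using f[OF that, of k] scaled_para[of "(real k)\<^sup>2 + j" "f k j" c S "real k" j]
      by (simp add: f_def)
    let ?x = "b00 * real i + b10 * real (Suc i) + b01 * real i + b11 * real (Suc i)"
    let ?z = "b00 * (f i 0 - 2) + b10 * (f (Suc i) 0 - 2) + b01 * (f i 1 - 2) + b11 * (f (Suc i) 1 - 2) + h"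
    have z: "?z = s - 1" using sums(1,4) by (simp add: algebra_simps)
    have "(b00 / S) *\<^sub>R vector [2 * real i, 2 * 0, f i 0 - 2]
        + (b10 / S) *\<^sub>R vector [2 * real (Suc i), 2 * 0, f (Suc i) 0 - 2]
        + (b01 / S) *\<^sub>R vector [2 * real i, 2 * 1, f i 1 - 2]
        + (b11 / S) *\<^sub>R vector [2 * real (Suc i), 2 * 1, f (Suc i) 1 - 2]
        + (h / S) *\<^sub>R vector [0, 0, 1]
        = (1 / S) *\<^sub>R (vector [2 * ?x, 2 * (b01 + b11), ?z] :: real^3)"
      by (simp add: vec_eq_iff forall_3 add_divide_distrib distrib_left mult.left_commute mult.commute del: of_nat_Suc)
    also have "\<dots> = p"
      unfolding sums(2,3) z by (simp add: p_eq(1) para_def S_def vec_eq_iff forall_3)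
    finally show ?thesis
      unfolding sc[OF order_refl] sc[OF zero_le_one] .
  qed
  finally show ?thesis unfolding V_def .
qed

lemma chain_vertices_ideal: "chain_vertices n \<subseteq> ideal_points"
proof -
  have "vector [0, 0, 1] \<in> ideal_points"
    by (simp add: ideal_points_def norm_eq_1 inner_vec_def sum_3)
  then show ?thesis using para_ideal by (auto simp: chain_vertices_def)
qed

text \<open>The walls pass through the apex, which lies strictly outside every hemisphere; for
  lattice vertices the caps are handled by \<open>square_ge_chord\<close>.\<close>

lemma chain_vertex_halfspace:
  assumes "v \<in> chain_vertices n" "u \<in> normals n"
  shows "lorentz u (v, 1) \<le> 0"
proof (cases "v = vector [0, 0, 1]")
  case True
  then show ?thesis
    using assms(2)
    by (auto simp: normals_def wall_left_def wall_right_def wall_front_def wall_back_def cap_def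
        lorentz_point inner_vec_def sum_3)
next
  case False
  then obtain k j where kj: "k \<le> n" "j = 0 \<or> j = (1::nat)"
    and v: "v = para (real k) (real j) ((real k)\<^sup>2 + (real j)\<^sup>2)"
    using assms(1) by (auto simp: chain_vertices_def)
  have s: "(real k)\<^sup>2 + (real j)\<^sup>2 + 1 > 0" by (smt (verit) zero_le_power2)
  have j2: "(real j)\<^sup>2 = real j" using kj(2) by auto
  have "(2 * real i + 1) * real k + real j - real i * (real i + 1) - ((real k)\<^sup>2 + (real j)\<^sup>2) \<le> 0" for i
    using square_ge_chord[of i k] j2 by linarith
  then have "lorentz (cap i) (v, 1) \<le> 0" for i
    unfolding v lorentz_normals_para[OF s] using s
    by (intro divide_nonpos_pos mult_nonneg_nonpos) simp_all
  moreover have "lorentz u (v, 1) \<le> 0" if "u \<in> {wall_left, wall_right n, wall_front, wall_back}"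
    using that kj s unfolding v by (auto simp: lorentz_normals_para divide_le_0_iff)
  ultimately show ?thesis using assms(2) unfolding normals_def by blast
qed

lemma chain_eq_hull:
  assumes "n > 0"
  shows "chain n = H3 \<inter> convex hull (chain_vertices n)"
proof
  show "chain n \<subseteq> H3 \<inter> convex hull (chain_vertices n)"
    using chain_subset_hull[OF assms] by (auto simp: chain_def)
  have "convex hull (chain_vertices n) \<subseteq> {x. fst u \<bullet> x \<le> snd u}" if "u \<in> normals n" for u
    using chain_vertex_halfspace[OF _ that]
    by (intro hull_minimal) (auto simp: lorentz_point convex_halfspace_le)
  then show "H3 \<inter> convex hull (chain_vertices n) \<subseteq> chain n"
    by (auto simp: chain_def hyp_halfspace_def lorentz_point subset_iff)
qed

lemma ideal_polytope_chain: "n > 0 \<Longrightarrow> ideal_polytope (chain n)"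
  by (rule halfspace_family.ideal_polytope[OF halfspace_family_chain _ chain_vertices_ideal chain_eq_hull])
     (auto simp: chain_vertices_def)

section \<open>Dihedral angles of the row\<close>

definition admissible_pair :: "(real^3) \<times> real \<Rightarrow> (real^3) \<times> real \<Rightarrow> bool" where
  "admissible_pair u v \<longleftrightarrow> (hyp_plane u \<inter> hyp_plane v \<noteq> {} \<longrightarrow>
     (\<exists>k::nat. k \<ge> 2 \<and> dihedral_angle u v = pi / real k))"

lemma admissible_pair_commute: "admissible_pair u v \<longleftrightarrow> admissible_pair v u"
  by (simp add: admissible_pair_def dihedral_angle_commute[of u v] Int_commute)

lemma admissible_pair_orthogonal: "lorentz u v = 0 \<Longrightarrow> admissible_pair u v"
  unfolding admissible_pair_def by (intro impI exI[of _ 2]) (simp add: dihedral_angle_def)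

lemma admissible_pair_pi_4:
  assumes "lorentz u v = -1" "lorentz u u = 1" "lorentz v v = 2"
  shows "admissible_pair u v"
proof -
  have "1 / sqrt 2 = cos (pi / 4)" by (simp add: cos_45 real_div_sqrt field_simps)
  then have "dihedral_angle u v = arccos (cos (pi / 4))"
    using assms by (simp add: dihedral_angle_def)
  also have "\<dots> = pi / real 4" by (subst arccos_cos) auto
  finally show ?thesis unfolding admissible_pair_def by (intro impI exI[of _ 4]) simp
qed

lemma admissible_pair_disjoint:
  assumes "\<And>x y s. x\<^sup>2 + y\<^sup>2 < s \<Longrightarrow> s + 1 > 0 \<Longrightarrow>
    lorentz u (para x y s, 1) = 0 \<Longrightarrow> lorentz v (para x y s, 1) = 0 \<Longrightarrow> False"
  shows "admissible_pair u v"
proof -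
  have "hyp_plane u \<inter> hyp_plane v = {}"
  proof (rule ccontr)
    assume "\<not> ?thesis"
    then obtain p where p: "p \<in> H3" "lorentz u (p, 1) = 0" "lorentz v (p, 1) = 0"
      by (auto simp: hyp_plane_def)
    obtain x y s where "p = para x y s" "x\<^sup>2 + y\<^sup>2 < s" "s > 0" using H3_paraE[OF p(1)] .
    then show False using assms[of x y s] p by simp
  qed
  then show ?thesis by (simp add: admissible_pair_def)
qed

text \<open>Neighbouring hemispheres have centres at distance 1, and their squared radii add up to
  1, so they are orthogonal; all others are disjoint.\<close>

lemma admissible_pair_caps:
  assumes "i \<noteq> j"
  shows "admissible_pair (cap i) (cap j)"
proof (cases "(real i - real j)\<^sup>2 = 1")
  case True
  then show ?thesis by (intro admissible_pair_orthogonal) (simp add: lorentz_products)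
next
  case False
  show ?thesis
  proof (rule admissible_pair_disjoint)
    fix x y s
    assume *: "x\<^sup>2 + y\<^sup>2 < s" "s + 1 > 0"
      "lorentz (cap i) (para x y s, 1) = 0" "lorentz (cap j) (para x y s, 1) = 0"
    have "\<bar>x - real i - 1 / 2\<bar> < 1" "\<bar>x - real j - 1 / 2\<bar> < 1"
      using * by (auto simp: lorentz_normals_para_zero intro!: cap_shadow[OF *(1)])
    then have "i = j \<or> i = j + 1 \<or> j = i + 1" by linarith
    then show False using False assms by auto
  qed
qed

text \<open>Only the first hemisphere reaches the wall. Its centre is at distance 1/2, which for
  radius \<open>1 / sqrt 2\<close> gives the angle \<open>pi / 4\<close>.\<close>

lemma admissible_pair_left_cap: "admissible_pair wall_left (cap i)"
proof (cases i)
  case 0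
  then show ?thesis by (intro admissible_pair_pi_4) (simp_all add: lorentz_products)
next
  case (Suc k)
  show ?thesis
  proof (rule admissible_pair_disjoint)
    fix x y s
    assume *: "x\<^sup>2 + y\<^sup>2 < s" "s + 1 > 0"
      "lorentz wall_left (para x y s, 1) = 0" "lorentz (cap i) (para x y s, 1) = 0"
    have "\<bar>x - real i - 1 / 2\<bar> < 1"
      using *(4) lorentz_normals_para_zero(5)[OF *(2), of i x y] by (intro cap_shadow[OF *(1)]) simp
    moreover have "x = 0" using *(3) lorentz_normals_para_zero(1)[OF *(2), of x y] by simp
    ultimately show False using Suc by simp
  qed
qed

lemma admissible_pair_right_cap:
  assumes "i < n"
  shows "admissible_pair (wall_right n) (cap i)"
proof (cases "n = Suc i")
  case True
  then show ?thesis by (intro admissible_pair_pi_4) (simp_all add: lorentz_products)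
next
  case False
  show ?thesis
  proof (rule admissible_pair_disjoint)
    fix x y s
    assume *: "x\<^sup>2 + y\<^sup>2 < s" "s + 1 > 0"
      "lorentz (wall_right n) (para x y s, 1) = 0" "lorentz (cap i) (para x y s, 1) = 0"
    have "\<bar>x - real i - 1 / 2\<bar> < 1"
      using *(4) lorentz_normals_para_zero(5)[OF *(2), of i x y] by (intro cap_shadow[OF *(1)]) simp
    moreover have "x = real n" using *(3) lorentz_normals_para_zero(2)[OF *(2), of n x y] by simp
    ultimately show False using False assms by linarith
  qed
qed

lemma admissible_pair_walls:
  "n > 0 \<Longrightarrow> admissible_pair wall_left (wall_right n)"
  "admissible_pair wall_front wall_back"
  by (rule admissible_pair_disjoint; simp add: lorentz_normals_para_zero)+

lemma admissible_pair_normals: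
  assumes "n > 0" "u \<in> normals n" "v \<in> normals n" "u \<noteq> v"
  shows "admissible_pair u v"
proof -
  have walls: "admissible_pair wall_left (wall_right n)" "admissible_pair wall_left wall_front"
    "admissible_pair wall_left wall_back" "admissible_pair (wall_right n) wall_front"
    "admissible_pair (wall_right n) wall_back" "admissible_pair wall_front wall_back"
    using admissible_pair_walls assms(1) by (simp_all add: admissible_pair_orthogonal lorentz_products)
  note walls' = walls[THEN admissible_pair_commute[THEN iffD1]]
  have front_cap: "admissible_pair wall_front (cap i)" and back_cap: "admissible_pair wall_back (cap i)" for i
    by (simp_all add: admissible_pair_pi_4 lorentz_products)
  have wall: "admissible_pair w v"
    if "w \<in> {wall_left, wall_right n, wall_front, wall_back}" "v \<in> normals n" "w \<noteq> v" for w v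
    using that walls walls' admissible_pair_left_cap admissible_pair_right_cap front_cap back_cap
    by (elim insertE emptyE) (auto simp: normals_def)
  consider "u \<in> {wall_left, wall_right n, wall_front, wall_back}"
    | "v \<in> {wall_left, wall_right n, wall_front, wall_back}"
    | i j where "u = cap i" "v = cap j"
    using assms(2,3) unfolding normals_def by blast
  then show ?thesis
  proof cases
    case 1
    then show ?thesis using wall assms by blast
  next
    case 2
    then show ?thesis using wall[of v u] assms admissible_pair_commute by blast
  next
    case (3 i j)
    then show ?thesis using admissible_pair_caps[of i j] assms(4) by auto
  qed
qed

lemma coxeter_polytope_chain:
  assumes "n > 0"
  shows "coxeter_polytope (chain n)"
proof (rule halfspace_family.coxeter_polytope[OF halfspace_family_chain[OF assms]])
  show "hyp_polytope (chain n)"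
    using ideal_polytope_chain[OF assms] by (simp add: ideal_polytope_def)
qed (use admissible_pair_normals[OF assms] in \<open>auto simp: admissible_pair_def\<close>)

section \<open>Growth rate of the row\<close>

lemma chain_reflections:
  assumes "n > 0"
  defines "S \<equiv> facet_reflections (chain n)"
  shows "S \<subseteq> carrier (BijGroup H3)" "finite S"
    "s \<in> S \<Longrightarrow> s \<otimes>\<^bsub>BijGroup H3\<^esub> s = \<one>\<^bsub>BijGroup H3\<^esub>"
    "u \<in> normals n \<Longrightarrow> hyp_reflection u \<in> S"
proof -
  interpret halfspace_family "normals n" "chain n" center by (rule halfspace_family_chain[OF assms(1)])
  show "S \<subseteq> carrier (BijGroup H3)" unfolding S_def by (rule facet_reflections_subset)
  show "finite S" using finite by (simp add: S_def facet_reflections)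
  show "s \<in> S \<Longrightarrow> s \<otimes>\<^bsub>BijGroup H3\<^esub> s = \<one>\<^bsub>BijGroup H3\<^esub>"
    using hyp_reflection_square[OF spacelike] by (auto simp: S_def facet_reflections)
  show "u \<in> normals n \<Longrightarrow> hyp_reflection u \<in> S" by (simp add: S_def facet_reflections)
qed

lemma chain_growth_rate_real:
  assumes "n > 0"
  shows "\<exists>\<tau>. ereal \<tau> = polytope_growth_rate (chain n)"
  unfolding polytope_growth_rate_def
  using chain_reflections[OF assms] by (intro group.growth_rate_real[OF group_BijGroup]) auto

text \<open>A row of \<open>2 * m + 1\<close> squares has the even caps
  \<open>0, 2, ..., 2 * m\<close>. The first supplies the fixed reflection, the other
  \<open>m\<close> the generators of the free monoid.\<close>

lemma chain_growth_rate_ge: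
  assumes R: "R \<ge> 1" "real m > 4 * R\<^sup>2"
  shows "ereal R \<le> polytope_growth_rate (chain (2 * m + 1))"
proof -
  let ?n = "2 * m + 1"
  have n: "?n > 0" by simp
  let ?r = "\<lambda>i. hyp_reflection (cap (2 * i))"
  have cap_normals: "cap (2 * i) \<in> normals ?n" if "i \<le> m" for i
    using that by (auto simp: normals_def)
  have sp: "spacelike (cap i)" for i by (simp add: spacelike_def lorentz_products)
  show ?thesis
    unfolding polytope_growth_rate_def
  proof (rule group.growth_rate_ge_of_free_monoid[OF group_BijGroup chain_reflections(1-3)[OF n],
        where I = "{1..m}" and r = ?r and t = "?r 0"])
    fix k
    show "inj_on (\<lambda>xs. foldr (\<otimes>\<^bsub>BijGroup H3\<^esub>) (concat (map (\<lambda>i. [?r i, ?r 0]) xs)) \<one>\<^bsub>BijGroup H3\<^esub>)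
        {xs. set xs \<subseteq> {1..m} \<and> length xs = k}"
    proof (rule reflections_free_monoid[where p = center])
      show "lorentz (cap (2 * j)) (x, 1) \<le> 0"
        if "i \<noteq> j" "x \<in> H3" "lorentz (cap (2 * i)) (x, 1) > 0" for i j x
        using cap_positive_sides_disjoint[OF that(2,3,1)] by simp
      show "lorentz (cap (2 * 0)) (x, 1) < 0"
        if "i \<in> {1..m}" "x \<in> H3" "lorentz (cap (2 * i)) (x, 1) > 0" for i x
        using cap_positive_sides_disjoint[OF that(2,3), of 0] that(1) by simp
      show "lorentz (cap (2 * i)) (x, 1) < 0"
        if "i \<in> {1..m}" "x \<in> H3" "lorentz (cap (2 * 0)) (x, 1) > 0" for i x
        using cap_positive_sides_disjoint[OF that(2,3), of i] that(1) by simp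
    qed (use sp center_in_H3 lorentz_cap_center in auto)
  qed (use R chain_reflections(4)[OF n cap_normals] chain_reflections(4)[OF n cap_normals[of 0]] in auto)
qed

theorem proposition2: "\<not> bdd_above ideal_coxeter_growth_rates"
proof
  assume "bdd_above ideal_coxeter_growth_rates"
  then obtain B where B: "\<And>\<tau>. \<tau> \<in> ideal_coxeter_growth_rates \<Longrightarrow> \<tau> \<le> B"
    by (auto simp: bdd_above_def)
  \<comment> \<open>\<open>R\<close> exceeds \<open>B\<close>, and the lower bound on the growth
    rate asks for \<open>R \<ge> 1\<close>.\<close>
  define R where "R = max 1 (B + 1)"
  obtain m :: nat where m: "real m > 4 * R\<^sup>2" using reals_Archimedean2 by blast
  let ?P = "chain (2 * m + 1)"
  obtain \<tau> where \<tau>: "ereal \<tau> = polytope_growth_rate ?P"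
    using chain_growth_rate_real[of "2 * m + 1"] by auto
  then have "\<tau> \<in> ideal_coxeter_growth_rates"
    using ideal_polytope_chain[of "2 * m + 1"] coxeter_polytope_chain[of "2 * m + 1"]
    by (auto simp: ideal_coxeter_growth_rates_def)
  then have "\<tau> \<le> B" by (rule B)
  moreover have "ereal R \<le> ereal \<tau>"
    unfolding \<tau> by (rule chain_growth_rate_ge[OF _ m]) (simp add: R_def)
  ultimately show False by (simp add: R_def)
qed

end
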